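(* Let $\ell$ be a prime and $L$ a discrete valuation field of characteristic zero and residue characteristic $\ell$. Let $K$ be a quadratic extension of $L$ which is unramified, $\mathfrak{m}$ the maximal ideal of $\mathcal{O}_K$, $k=\mathcal{O}_K/\mathfrak{m}$ (a quadratic extension of the residue field $k_L$ of $L$). Let $e=e(K)$ and suppose $2e<\ell-1$. Let $V$ be a $K$-vector space of finite dimension $n$, $f:V\times V\to K$ a nondegenerate pairing which is hermitian (respectively, skew-hermitian) with respect to $K/L$, $G$ a finite group, and $\rho:G\hookrightarrow\mathrm{Aut}_K(V,f)$ a faithful representation. Then there exist a nondegenerate $k$-valued pairing $f_0$ on $k^n$ which is hermitian (respectively, skew-hermitian) with respect to $k/k_L$, and a faithful representation $\bar\rho:G\hookrightarrow\mathrm{Aut}_k(k^n,f_0)$, such that for every $g\in G$ the characteristic polynomial of $\bar\rho(g)$ is the reduction modulo $\mathfrak{m}$ of the characteristic polynomial of $\rho(g)$.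
   Context: $e(K)=v(\ell)$ where $v$ is the normalized valuation of $K$ ($v(K^\times)=\mathbf{Z}$); $\mathcal{O}_K$ is the valuation ring. *)

theory Defs
  imports "Jordan_Normal_Form.Char_Poly" "HOL-Algebra.Group"
begin

text \<open>The value of \<open>val\<close> at \<open>0\<close> (mathematically, infinity) is left unspecified, so \<open>0\<close> is always
  treated separately below. Completeness is not assumed.\<close>

class discrete_valuation_field = field +
  fixes val :: "'a \<Rightarrow> int"
  assumes val_mult: "x \<noteq> 0 \<Longrightarrow> y \<noteq> 0 \<Longrightarrow> val (x * y) = val x + val y"
    and val_add: "x \<noteq> 0 \<Longrightarrow> y \<noteq> 0 \<Longrightarrow> x + y \<noteq> 0 \<Longrightarrow> min (val x) (val y) \<le> val (x + y)"
    and val_normalized: "val ` (UNIV - {0}) = UNIV"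

definition valuation_ring :: "'a::discrete_valuation_field set" where
  "valuation_ring = {x. x = 0 \<or> 0 \<le> val x}"

definition valuation_ideal :: "'a::discrete_valuation_field set" where
  "valuation_ideal = {x. x = 0 \<or> 0 < val x}"

lemma val_one [simp]: "val (1::'a::discrete_valuation_field) = 0"
  using val_mult[of "1::'a" 1] by simp

lemma val_uminus [simp]: "val (- x :: 'a::discrete_valuation_field) = val x"
proof (cases "x = 0")
  case False
  have "val (-1::'a) + val (-1::'a) = 0"
    using val_mult[of "-1::'a" "-1"] by simp
  then show ?thesis using val_mult[of "-1" x] False by simp
qed simp

lemma val_inverse: "x \<noteq> 0 \<Longrightarrow> val (inverse x :: 'a::discrete_valuation_field) = - val x"
  using val_mult[of x "inverse x"] by simp

lemma valuation_ring_add: "x \<in> valuation_ring \<Longrightarrow> y \<in> valuation_ring \<Longrightarrow> x + y \<in> valuation_ring"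
  using val_add[of x y] by (cases "x = 0 \<or> y = 0 \<or> x + y = 0") (auto simp: valuation_ring_def)

lemma valuation_ring_mult: "x \<in> valuation_ring \<Longrightarrow> y \<in> valuation_ring \<Longrightarrow> x * y \<in> valuation_ring"
  using val_mult[of x y] by (cases "x = 0 \<or> y = 0") (auto simp: valuation_ring_def)

lemma valuation_ring_uminus: "x \<in> valuation_ring \<Longrightarrow> - x \<in> valuation_ring"
  by (auto simp: valuation_ring_def)

lemma valuation_ideal_add: "x \<in> valuation_ideal \<Longrightarrow> y \<in> valuation_ideal \<Longrightarrow> x + y \<in> valuation_ideal"
  using val_add[of x y] by (cases "x = 0 \<or> y = 0 \<or> x + y = 0") (auto simp: valuation_ideal_def)

lemma valuation_ideal_uminus: "x \<in> valuation_ideal \<Longrightarrow> - x \<in> valuation_ideal"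
  by (auto simp: valuation_ideal_def)

lemma valuation_ideal_mult: "x \<in> valuation_ring \<Longrightarrow> y \<in> valuation_ideal \<Longrightarrow> x * y \<in> valuation_ideal"
  using val_mult[of x y]
  by (cases "x = 0 \<or> y = 0") (auto simp: valuation_ring_def valuation_ideal_def)

lemma valuation_ring_0: "0 \<in> valuation_ring" and valuation_ring_1: "1 \<in> valuation_ring"
  and valuation_ideal_0: "0 \<in> valuation_ideal" and valuation_ideal_1: "1 \<notin> valuation_ideal"
  by (auto simp: valuation_ring_def valuation_ideal_def)

lemma val_eq_0_iff:
  "x \<in> valuation_ring \<Longrightarrow> x \<notin> valuation_ideal \<longleftrightarrow> x \<noteq> 0 \<and> val x = 0"
  by (auto simp: valuation_ring_def valuation_ideal_def)

definition residue_rel :: "'a::discrete_valuation_field \<Rightarrow> 'a \<Rightarrow> bool" where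
  "residue_rel x y \<longleftrightarrow> x \<in> valuation_ring \<and> y \<in> valuation_ring \<and> x - y \<in> valuation_ideal"

lemma part_equivp_residue_rel: "part_equivp residue_rel"
proof (rule part_equivpI)
  show "\<exists>x. residue_rel x x"
    by (intro exI[of _ 0]) (simp add: residue_rel_def valuation_ring_0 valuation_ideal_0)
  show "symp residue_rel"
    using valuation_ideal_uminus by (fastforce intro!: sympI simp: residue_rel_def)
  show "transp residue_rel"
    using valuation_ideal_add by (fastforce intro!: transpI simp: residue_rel_def)
qed

text \<open>A partial quotient of the whole field: since \<open>residue_rel\<close> is only reflexive on the valuation
  ring, this is the valuation ring modulo its maximal ideal.\<close>

quotient_type (overloaded) 'a residue_field = "'a::discrete_valuation_field" / partial: residue_rel
  by (rule part_equivp_residue_rel)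

instantiation residue_field :: (discrete_valuation_field) field
begin

lift_definition zero_residue_field :: "'a residue_field" is 0
  by (simp add: residue_rel_def valuation_ring_0 valuation_ideal_0)

lift_definition one_residue_field :: "'a residue_field" is 1
  by (simp add: residue_rel_def valuation_ring_1 valuation_ideal_0)

lift_definition plus_residue_field :: "'a residue_field \<Rightarrow> 'a residue_field \<Rightarrow> 'a residue_field" is "(+)"
  using valuation_ideal_add
  by (fastforce simp: residue_rel_def valuation_ring_add add_diff_add)

lift_definition uminus_residue_field :: "'a residue_field \<Rightarrow> 'a residue_field" is uminus
  using valuation_ideal_uminus
  by (fastforce simp: residue_rel_def valuation_ring_uminus)

lift_definition minus_residue_field :: "'a residue_field \<Rightarrow> 'a residue_field \<Rightarrow> 'a residue_field" is "(-)"
proof -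
  fix a b c d :: 'a
  assume ab: "residue_rel a b" and cd: "residue_rel c d"
  have "(a - b) + - (c - d) \<in> valuation_ideal"
    using ab cd valuation_ideal_add valuation_ideal_uminus unfolding residue_rel_def by blast
  moreover have "a + - c \<in> valuation_ring" "b + - d \<in> valuation_ring"
    using ab cd valuation_ring_add valuation_ring_uminus unfolding residue_rel_def by blast+
  ultimately show "residue_rel (a - c) (b - d)"
    by (simp add: residue_rel_def algebra_simps)
qed

lift_definition times_residue_field :: "'a residue_field \<Rightarrow> 'a residue_field \<Rightarrow> 'a residue_field" is "(*)"
proof -
  fix a b c d :: 'a
  assume ab: "residue_rel a b" and cd: "residue_rel c d"
  have "c * (a - b) + b * (c - d) \<in> valuation_ideal"
    using ab cd valuation_ideal_add valuation_ideal_mult unfolding residue_rel_def by blast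
  moreover have "c * (a - b) + b * (c - d) = a * c - b * d"
    by (simp add: algebra_simps)
  ultimately show "residue_rel (a * c) (b * d)"
    using ab cd by (simp add: residue_rel_def valuation_ring_mult)
qed

lift_definition inverse_residue_field :: "'a residue_field \<Rightarrow> 'a residue_field"
  is "\<lambda>x. if x \<in> valuation_ideal then 0 else inverse x"
proof -
  fix a b :: 'a
  assume ab: "residue_rel a b"
  have iff: "a \<in> valuation_ideal \<longleftrightarrow> b \<in> valuation_ideal"
  proof
    assume "a \<in> valuation_ideal"
    then have "a + - (a - b) \<in> valuation_ideal"
      using ab valuation_ideal_add valuation_ideal_uminus unfolding residue_rel_def by blast
    then show "b \<in> valuation_ideal" by simp
  next
    assume "b \<in> valuation_ideal"
    then have "b + (a - b) \<in> valuation_ideal"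
      using ab valuation_ideal_add unfolding residue_rel_def by blast
    then show "a \<in> valuation_ideal" by simp
  qed
  show "residue_rel (if a \<in> valuation_ideal then 0 else inverse a)
          (if b \<in> valuation_ideal then 0 else inverse b)"
  proof (cases "a \<in> valuation_ideal")
    case True
    then show ?thesis using iff by (simp add: residue_rel_def valuation_ring_0 valuation_ideal_0)
  next
    case False
    then have a: "a \<noteq> 0" "val a = 0" and b: "b \<noteq> 0" "val b = 0"
      using ab iff val_eq_0_iff unfolding residue_rel_def by blast+
    have inv: "inverse a \<in> valuation_ring" "inverse b \<in> valuation_ring"
      using a b by (auto simp: valuation_ring_def val_inverse)
    have "(inverse a * inverse b) * - (a - b) \<in> valuation_ideal"
      using ab inv valuation_ideal_mult valuation_ring_mult valuation_ideal_uminus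
      unfolding residue_rel_def by blast
    moreover have "(inverse a * inverse b) * - (a - b) = inverse a - inverse b"
      using a b by (simp add: field_simps)
    ultimately show ?thesis using iff False inv by (simp add: residue_rel_def)
  qed
qed

definition divide_residue_field :: "'a residue_field \<Rightarrow> 'a residue_field \<Rightarrow> 'a residue_field" where
  "divide_residue_field a b = a * inverse b"

instance
proof
  fix a b c :: "'a residue_field"
  show "a * b * c = a * (b * c)"
    by transfer (simp add: residue_rel_def valuation_ring_mult valuation_ideal_0 mult.assoc)
  show "a * b = b * a"
    by transfer (simp add: residue_rel_def valuation_ring_mult valuation_ideal_0 mult.commute)
  show "1 * a = a"
    by transfer (simp add: residue_rel_def)
  show "a + b + c = a + (b + c)"
    by transfer (simp add: residue_rel_def valuation_ring_add valuation_ideal_0 add.assoc)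
  show "a + b = b + a"
    by transfer (simp add: residue_rel_def valuation_ring_add valuation_ideal_0 add.commute)
  show "0 + a = a"
    by transfer (simp add: residue_rel_def)
  show "- a + a = 0"
    by transfer (simp add: residue_rel_def valuation_ring_0 valuation_ideal_0)
  show "a - b = a + - b"
  proof transfer
    fix a b :: 'a
    assume "residue_rel a a" "residue_rel b b"
    then show "residue_rel (a - b) (a + - b)"
      using valuation_ring_add[of a "- b"] valuation_ring_uminus[of b]
      by (simp add: residue_rel_def valuation_ideal_0)
  qed
  show "(a + b) * c = a * c + b * c"
    by transfer
      (simp add: residue_rel_def valuation_ring_mult valuation_ring_add valuation_ideal_0 distrib_right)
  show "(0::'a residue_field) \<noteq> 1"
    by transfer
      (use valuation_ideal_uminus[of "-1::'a"] valuation_ideal_1 in \<open>auto simp: residue_rel_def\<close>)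
  show "inverse a * a = 1" if "a \<noteq> 0"
    using that
  proof transfer
    fix a :: 'a
    assume a: "residue_rel a a" and "\<not> residue_rel a 0"
    then have "a \<notin> valuation_ideal" and "a \<in> valuation_ring"
      by (auto simp: residue_rel_def valuation_ring_0)
    then show "residue_rel ((if a \<in> valuation_ideal then 0 else inverse a) * a) 1"
      using val_eq_0_iff[of a] by (simp add: residue_rel_def valuation_ring_1 valuation_ideal_0)
  qed
  show "a div b = a * inverse b"
    by (rule divide_residue_field_def)
  show "inverse (0::'a residue_field) = 0"
    by transfer (simp add: residue_rel_def valuation_ring_0 valuation_ideal_0)
qed

end

text \<open>Unspecified outside the valuation ring; hence the integrality condition in \<open>reduces_to\<close>.\<close>

definition residue :: "'a::discrete_valuation_field \<Rightarrow> 'a residue_field" where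
  "residue x = abs_residue_field x"

lemma residue_eq_iff:
  "x \<in> valuation_ring \<Longrightarrow> y \<in> valuation_ring \<Longrightarrow> residue x = residue y \<longleftrightarrow> x - y \<in> valuation_ideal"
  using Quotient3_rel[OF Quotient3_residue_field, of x y]
  by (auto simp: residue_def residue_rel_def valuation_ideal_0)

lemma residue_surj: "\<exists>x\<in>valuation_ring. residue x = a"
  using Quotient3_rep_reflp[OF Quotient3_residue_field, of a]
    Quotient3_abs_rep[OF Quotient3_residue_field, of a]
  unfolding residue_def residue_rel_def by blast

lemma residue_0: "residue 0 = 0" and residue_1: "residue 1 = 1"
  by (simp_all add: residue_def zero_residue_field.abs_eq one_residue_field.abs_eq)

lemma residue_add:
  "x \<in> valuation_ring \<Longrightarrow> y \<in> valuation_ring \<Longrightarrow> residue (x + y) = residue x + residue y"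
  by (simp add: residue_def plus_residue_field.abs_eq residue_rel_def valuation_ideal_0)

lemma residue_mult:
  "x \<in> valuation_ring \<Longrightarrow> y \<in> valuation_ring \<Longrightarrow> residue (x * y) = residue x * residue y"
  by (simp add: residue_def times_residue_field.abs_eq residue_rel_def valuation_ideal_0)

definition reduces_to ::
    "'a::discrete_valuation_field poly \<Rightarrow> 'a residue_field poly \<Rightarrow> bool" where
  "reduces_to p q \<longleftrightarrow> (\<forall>i. coeff p i \<in> valuation_ring) \<and> map_poly residue p = q"

text \<open>An extension \<open>E/F\<close> is given by a field embedding \<open>\<iota> : F \<rightarrow> E\<close>. By the convention for \<open>dim\<close>,
  an extension of infinite degree gets degree \<open>0\<close>.\<close>

definition ext_degree :: "('f::field \<Rightarrow> 'e::field) \<Rightarrow> nat" where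
  "ext_degree \<iota> = vector_space.dim (\<lambda>a x. \<iota> a * x) (UNIV :: 'e set)"

definition separable_extension :: "('f::field \<Rightarrow> 'e::field) \<Rightarrow> bool" where
  "separable_extension \<iota> \<longleftrightarrow>
     (\<forall>x. \<exists>p. p \<noteq> 0 \<and> coprime p (pderiv p) \<and> poly (map_poly \<iota> p) x = 0)"

text \<open>The embedding of residue fields induced by \<open>\<iota>\<close>. It does not depend on the chosen
  representative when \<open>\<iota>\<close> is compatible with the valuations.\<close>

definition residue_map ::
    "('l::discrete_valuation_field \<Rightarrow> 'k::discrete_valuation_field) \<Rightarrow>
      'l residue_field \<Rightarrow> 'k residue_field" where
  "residue_map \<iota> a = residue (\<iota> (SOME x. x \<in> valuation_ring \<and> residue x = a))"

text \<open>The valuation of \<open>K\<close> extends that of \<open>L\<close> with ramification index \<open>1\<close> (both valuations being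
  normalized), and the residue extension is separable of degree \<open>[K:L]\<close>. As \<open>L\<close> need not be
  henselian, the last condition does not follow from the others (it fails if the valuation of \<open>L\<close>
  splits in \<open>K\<close>).\<close>

definition unramified_extension ::
    "('l::discrete_valuation_field \<Rightarrow> 'k::discrete_valuation_field) \<Rightarrow> bool" where
  "unramified_extension \<iota> \<longleftrightarrow>
     field_hom \<iota> \<and> (\<forall>x. x \<noteq> 0 \<longrightarrow> val (\<iota> x) = val x) \<and>
     separable_extension (residue_map \<iota>) \<and> ext_degree (residue_map \<iota>) = ext_degree \<iota>"

text \<open>For a separable quadratic extension there is exactly one such \<open>\<sigma>\<close>.\<close>

definition conjugation :: "('f::field \<Rightarrow> 'e::field) \<Rightarrow> ('e \<Rightarrow> 'e) \<Rightarrow> bool" where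
  "conjugation \<iota> \<sigma> \<longleftrightarrow> field_hom \<sigma> \<and> bij \<sigma> \<and> (\<forall>x. \<sigma> (\<iota> x) = \<iota> x) \<and> \<sigma> \<noteq> id"

text \<open>Pairings on a vector space with carrier \<open>U\<close> and scalar multiplication \<open>sc\<close>, so that the notions
  apply both to an abstract vector space (\<open>U = UNIV\<close>) and to \<open>carrier_vec n\<close>. Pairings are linear
  in the first and semilinear in the second argument.\<close>

definition sesquilinear ::
    "'v::plus set \<Rightarrow> ('e::field \<Rightarrow> 'v \<Rightarrow> 'v) \<Rightarrow> ('e \<Rightarrow> 'e) \<Rightarrow> ('v \<Rightarrow> 'v \<Rightarrow> 'e) \<Rightarrow> bool" where
  "sesquilinear U sc \<sigma> f \<longleftrightarrow>
     (\<forall>x\<in>U. \<forall>y\<in>U. \<forall>z\<in>U. f (x + y) z = f x z + f y z \<and> f x (y + z) = f x y + f x z) \<and>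
     (\<forall>a. \<forall>x\<in>U. \<forall>y\<in>U. f (sc a x) y = a * f x y \<and> f x (sc a y) = \<sigma> a * f x y)"

definition hermitian ::
    "('f::field \<Rightarrow> 'e::field) \<Rightarrow> 'v::plus set \<Rightarrow> ('e \<Rightarrow> 'v \<Rightarrow> 'v) \<Rightarrow> ('v \<Rightarrow> 'v \<Rightarrow> 'e) \<Rightarrow> bool" where
  "hermitian \<iota> U sc f \<longleftrightarrow>
     (\<exists>\<sigma>. conjugation \<iota> \<sigma> \<and> sesquilinear U sc \<sigma> f \<and> (\<forall>x\<in>U. \<forall>y\<in>U. f y x = \<sigma> (f x y)))"

definition skew_hermitian ::
    "('f::field \<Rightarrow> 'e::field) \<Rightarrow> 'v::plus set \<Rightarrow> ('e \<Rightarrow> 'v \<Rightarrow> 'v) \<Rightarrow> ('v \<Rightarrow> 'v \<Rightarrow> 'e) \<Rightarrow> bool" where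
  "skew_hermitian \<iota> U sc f \<longleftrightarrow>
     (\<exists>\<sigma>. conjugation \<iota> \<sigma> \<and> sesquilinear U sc \<sigma> f \<and> (\<forall>x\<in>U. \<forall>y\<in>U. f y x = - \<sigma> (f x y)))"

definition nondegenerate :: "'v set \<Rightarrow> 'v \<Rightarrow> ('v \<Rightarrow> 'v \<Rightarrow> 'e::zero) \<Rightarrow> bool" where
  "nondegenerate U z f \<longleftrightarrow>
     (\<forall>x\<in>U. (\<forall>y\<in>U. f x y = 0) \<longrightarrow> x = z) \<and> (\<forall>y\<in>U. (\<forall>x\<in>U. f x y = 0) \<longrightarrow> y = z)"

definition Aut_pairing ::
    "('e::field \<Rightarrow> 'v::ab_group_add \<Rightarrow> 'v) \<Rightarrow> ('v \<Rightarrow> 'v \<Rightarrow> 'e) \<Rightarrow> ('v \<Rightarrow> 'v) monoid" where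
  "Aut_pairing sc f =
     \<lparr>carrier = {T. Vector_Spaces.linear sc sc T \<and> bij T \<and> (\<forall>x y. f (T x) (T y) = f x y)},
      mult = (\<circ>), one = id\<rparr>"

definition Aut_pairing_vec :: "nat \<Rightarrow> ('e::field vec \<Rightarrow> 'e vec \<Rightarrow> 'e) \<Rightarrow> 'e mat monoid" where
  "Aut_pairing_vec n f =
     \<lparr>carrier = {A \<in> carrier_mat n n. invertible_mat A \<and>
        (\<forall>x\<in>carrier_vec n. \<forall>y\<in>carrier_vec n. f (A *\<^sub>v x) (A *\<^sub>v y) = f x y)},
      mult = (*), one = 1\<^sub>m n\<rparr>"

definition ordered_basis ::
    "('e::field \<Rightarrow> 'v::ab_group_add \<Rightarrow> 'v) \<Rightarrow> 'v list \<Rightarrow> bool" where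
  "ordered_basis sc bs \<longleftrightarrow> distinct bs \<and> finite_dimensional_vector_space sc (set bs)"

definition matrix_of ::
    "('e::field \<Rightarrow> 'v::ab_group_add \<Rightarrow> 'v) \<Rightarrow> 'v list \<Rightarrow> ('v \<Rightarrow> 'v) \<Rightarrow> 'e mat" where
  "matrix_of sc bs T =
     mat (length bs) (length bs)
       (\<lambda>(i, j). Modules.module.representation sc (set bs) (T (bs ! j)) (bs ! i))"

text \<open>The characteristic polynomial of a linear endomorphism, computed in some ordered basis;
  as usual, it is the same for all of them.\<close>

definition endo_char_poly ::
    "('e::field \<Rightarrow> 'v::ab_group_add \<Rightarrow> 'v) \<Rightarrow> ('v \<Rightarrow> 'v) \<Rightarrow> 'e poly" where
  "endo_char_poly sc T = char_poly (matrix_of sc (SOME bs. ordered_basis sc bs) T)"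

end

theory Submission
  imports Defs "HOL-Algebra.Multiplicative_Group"
begin

text \<open>The span of the \<open>G\<close>-translates of a basis over the valuation ring is an invariant lattice.
  As the residue characteristic is odd and \<open>K/L\<close> is unramified, it has an orthogonal basis, and
  dividing the basis vectors by suitable powers of a uniformizer \<open>\<pi>\<close> of \<open>L\<close> yields another
  invariant lattice \<open>T\<close>, with an orthogonal basis \<open>y\<close> such that all \<open>f (y i) (y i)\<close> have
  valuation \<open>0\<close> or \<open>1\<close>. Thus \<open>\<pi> T* \<subseteq> T \<subseteq> T*\<close> for the dual lattice \<open>T*\<close>; the forms \<open>f\<close> on
  \<open>T / \<pi> T*\<close> and \<open>f / \<pi>\<close> on \<open>\<pi> T* / \<pi> T\<close> reduce to nondegenerate ones, and \<open>G\<close> acts on their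
  orthogonal sum, a graded space of \<open>T / \<pi> T\<close>, with the same characteristic polynomials.
  An element \<open>1 + h\<close> in the kernel of this action satisfies \<open>h\<^sup>2 T \<subseteq> \<pi> T\<close>. If it has prime order
  \<open>p\<close>, then \<open>(1 + h)\<^sup>p = 1\<close> reads \<open>p h + \<dots> + h\<^sup>p = 0\<close>, where all terms but the last are
  divisible by \<open>p\<close>; since \<open>p\<close> is a unit or \<open>2 e < p - 1\<close>, this forces \<open>h = 0\<close>.\<close>

section \<open>Fractional ideals of a discrete valuation field\<close>

text \<open>The fractional ideals, indexed by all integers so that the valuation ring
  (\<open>k = 0\<close>), the maximal ideal (\<open>k = 1\<close>) and bounded denominators obey the
  same rules. Zero is listed separately because \<open>val 0\<close> is unspecified.\<close>

definition val_ge :: "int \<Rightarrow> 'a::discrete_valuation_field set" where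
  "val_ge k = {x. x = 0 \<or> k \<le> val x}"

lemma valuation_ring_eq_val_ge: "valuation_ring = val_ge 0"
  by (auto simp: valuation_ring_def val_ge_def)

lemma valuation_ideal_eq_val_ge: "valuation_ideal = val_ge 1"
  by (auto simp: valuation_ideal_def val_ge_def)

lemma val_ge_0 [simp]: "0 \<in> val_ge k"
  by (simp add: val_ge_def)

lemma val_ge_add: "x \<in> val_ge k \<Longrightarrow> y \<in> val_ge k \<Longrightarrow> x + y \<in> val_ge k"
  using val_add[of x y] by (cases "x = 0 \<or> y = 0 \<or> x + y = 0") (auto simp: val_ge_def)

lemma val_ge_uminus: "x \<in> val_ge k \<Longrightarrow> - x \<in> val_ge k"
  by (auto simp: val_ge_def)

lemma val_ge_diff: "x \<in> val_ge k \<Longrightarrow> y \<in> val_ge k \<Longrightarrow> x - y \<in> val_ge k"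
  using val_ge_add[of x k "- y"] val_ge_uminus[of y k] by simp

lemma val_ge_sum: "(\<And>i. i \<in> A \<Longrightarrow> g i \<in> val_ge k) \<Longrightarrow> sum g A \<in> val_ge k"
  by (induction A rule: infinite_finite_induct) (auto intro: val_ge_add)

lemma val_ge_mult: "x \<in> val_ge j \<Longrightarrow> y \<in> val_ge k \<Longrightarrow> x * y \<in> val_ge (j + k)"
  using val_mult[of x y] by (cases "x = 0 \<or> y = 0") (auto simp: val_ge_def)

lemma val_ge_mono: "x \<in> val_ge j \<Longrightarrow> k \<le> j \<Longrightarrow> x \<in> val_ge k"
  by (auto simp: val_ge_def)

lemma val_ge_mult_le: "x \<in> val_ge j \<Longrightarrow> y \<in> val_ge k \<Longrightarrow> m \<le> j + k \<Longrightarrow> x * y \<in> val_ge m"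
  using val_ge_mult val_ge_mono by blast

lemma val_ge_1 [simp]: "1 \<in> val_ge 0"
  by (simp add: val_ge_def)

lemma val_ge_self [simp]: "x \<in> val_ge (val x)"
  by (simp add: val_ge_def)

lemma val_divide:
  "x \<noteq> 0 \<Longrightarrow> y \<noteq> 0 \<Longrightarrow> val (x / y :: 'a::discrete_valuation_field) = val x - val y"
  using val_mult[of x "inverse y"] val_inverse[of y] by (simp add: field_simps)

lemma val_ge_divide:
  "x \<in> val_ge j \<Longrightarrow> y \<noteq> 0 \<Longrightarrow> k \<le> j - val y \<Longrightarrow> x / y \<in> val_ge k"
  using val_divide[of x y] by (cases "x = 0") (auto simp: val_ge_def)

lemma val_power_int:
  "x \<noteq> 0 \<Longrightarrow> val (x powi k :: 'a::discrete_valuation_field) = k * val x"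
proof -
  assume x: "x \<noteq> 0"
  have nat: "val (x ^ m) = int m * val x" for m
    by (induction m) (auto simp: val_mult x algebra_simps)
  show ?thesis
    using x by (auto simp: power_int_def nat val_inverse power_inverse)
qed

lemma of_nat_val_ge: "of_nat m \<in> val_ge 0"
  by (induction m) (auto intro: val_ge_add)

lemma val_ge_eq_0: "(\<And>k. x \<in> val_ge k) \<Longrightarrow> x = 0"
proof (rule ccontr)
  assume "\<And>k. x \<in> val_ge k" "x \<noteq> 0"
  then have "val x + 1 \<le> val x" unfolding val_ge_def by blast
  then show False by simp
qed

lemma residue_eq_0_iff: "x \<in> val_ge 0 \<Longrightarrow> residue x = 0 \<longleftrightarrow> x \<in> val_ge 1"
  using residue_eq_iff[of x 0]
  by (simp add: residue_0 valuation_ring_eq_val_ge valuation_ideal_eq_val_ge)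

lemma residue_eq_0: "x \<in> val_ge 1 \<Longrightarrow> residue x = 0"
  using val_ge_mono[of x 1 0] by (simp add: residue_eq_0_iff)

lemma residue_eq_iff_val_ge:
  "x \<in> val_ge 0 \<Longrightarrow> y \<in> val_ge 0 \<Longrightarrow> residue x = residue y \<longleftrightarrow> x - y \<in> val_ge 1"
  using residue_eq_iff[of x y]
  by (simp add: valuation_ring_eq_val_ge valuation_ideal_eq_val_ge)

lemma residue_uminus: "x \<in> val_ge 0 \<Longrightarrow> residue (- x) = - residue x"
  using residue_add[of x "- x"] val_ge_uminus[of x 0]
  by (simp add: valuation_ring_eq_val_ge residue_0 eq_neg_iff_add_eq_0 add.commute)

lemma residue_sum:
  "(\<And>i. i \<in> A \<Longrightarrow> g i \<in> val_ge 0) \<Longrightarrow> residue (sum g A) = (\<Sum>i\<in>A. residue (g i))"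
proof (induction A rule: infinite_finite_induct)
  case (insert i A)
  then show ?case
    using residue_add[of "g i" "sum g A"] val_ge_sum[of A g 0] by (simp add: valuation_ring_eq_val_ge)
qed (simp_all add: residue_0)

lemma residue_of_nat: "residue (of_nat m) = of_nat m"
  by (induction m)
    (auto simp: residue_0 residue_1 residue_add valuation_ring_eq_val_ge of_nat_val_ge)

lemma residue_cases:
  obtains x where "x \<in> val_ge 0" "residue x = a"
  using residue_surj[of a] by (auto simp: valuation_ring_eq_val_ge)

lemma residue_mult_val_ge:
  "x \<in> val_ge 0 \<Longrightarrow> y \<in> val_ge 0 \<Longrightarrow> residue (x * y) = residue x * residue y"
  by (simp add: residue_mult valuation_ring_eq_val_ge)

lemma residue_add_val_ge:
  "x \<in> val_ge 0 \<Longrightarrow> y \<in> val_ge 0 \<Longrightarrow> residue (x + y) = residue x + residue y"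
  by (simp add: residue_add valuation_ring_eq_val_ge)

section \<open>Unramified quadratic extensions\<close>

text \<open>\<open>\<sigma>\<close> is a parameter because a hermitian form only provides some
  conjugation. Invertibility of 2 in the valuation ring is what makes traces surjective and
  orthogonal bases available.\<close>

locale unramified_quadratic =
  fixes \<iota> :: "'l::discrete_valuation_field \<Rightarrow> 'k::discrete_valuation_field" and \<sigma> :: "'k \<Rightarrow> 'k"
  assumes unramified: "unramified_extension \<iota>"
    and degree_two: "ext_degree \<iota> = 2"
    and conj: "conjugation \<iota> \<sigma>"
    and odd_residue_char: "(2 :: 'k) \<notin> val_ge 1"
begin

sublocale embed: field_hom \<iota>
  using unramified by (simp add: unramified_extension_def)

sublocale conj: field_hom \<sigma>
  using conj by (simp add: conjugation_def)

lemma conj_embed: "\<sigma> (\<iota> x) = \<iota> x"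
  using conj by (simp add: conjugation_def)

lemma val_embed: "x \<noteq> 0 \<Longrightarrow> val (\<iota> x) = val x"
  using unramified by (simp add: unramified_extension_def)

lemma embed_val_ge_iff: "\<iota> x \<in> val_ge k \<longleftrightarrow> x \<in> val_ge k"
  by (cases "x = 0") (auto simp: val_ge_def val_embed)

text \<open>Ramification index 1 lets the uniformizer be taken in L. Being fixed by
  \<open>\<sigma>\<close>, its powers rescale forms without disturbing their symmetry.\<close>

lemma uniformizer: obtains \<pi> :: 'k where "\<pi> \<noteq> 0" "val \<pi> = 1" "\<sigma> \<pi> = \<pi>"
proof -
  have "(1::int) \<in> val ` (UNIV - {0::'l})" by (simp add: val_normalized)
  then obtain p :: 'l where "p \<noteq> 0" "val p = 1" by (metis DiffE imageE singletonI)
  then show ?thesis using that[of "\<iota> p"] by (simp add: val_embed conj_embed)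
qed

lemma residue_map_residue: "x \<in> val_ge 0 \<Longrightarrow> residue_map \<iota> (residue x) = residue (\<iota> x)"
proof -
  assume x: "x \<in> val_ge 0"
  define y where "y = (SOME y. y \<in> valuation_ring \<and> residue y = residue x)"
  have "y \<in> valuation_ring \<and> residue y = residue x"
    unfolding y_def by (rule someI[of _ x]) (simp add: x valuation_ring_eq_val_ge)
  then have y: "y \<in> val_ge 0" "y - x \<in> val_ge 1"
    using x residue_eq_iff_val_ge[of y x] by (auto simp: valuation_ring_eq_val_ge)
  then have "residue (\<iota> y) = residue (\<iota> x)"
    using x by (subst residue_eq_iff_val_ge)
      (auto simp: embed_val_ge_iff simp flip: embed.hom_minus)
  then show ?thesis by (simp add: residue_map_def y_def)
qed

text \<open>If the embedding of residue fields were onto, \<open>{1}\<close> would span the residue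
  field of K over that of L, whereas the residue degree is 2.\<close>

lemma generator:
  obtains \<theta> where "\<theta> \<in> val_ge 0" "residue \<theta> \<notin> range (residue_map \<iota>)"
proof -
  have hom1: "residue_map \<iota> 1 = 1"
    using residue_map_residue[of 1] by (simp add: residue_1)
  have radd: "residue_map \<iota> (a + b) = residue_map \<iota> a + residue_map \<iota> b" for a b
  proof -
    obtain x y where "x \<in> val_ge 0" "residue x = a" "y \<in> val_ge 0" "residue y = b"
      by (metis residue_cases)
    then show ?thesis
      using residue_map_residue[of x] residue_map_residue[of y] residue_map_residue[of "x + y"]
      by (auto simp: residue_add_val_ge val_ge_add embed.hom_add embed_val_ge_iff)
  qed
  have rmult: "residue_map \<iota> (a * b) = residue_map \<iota> a * residue_map \<iota> b" for a b
  proof -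
    obtain x y where "x \<in> val_ge 0" "residue x = a" "y \<in> val_ge 0" "residue y = b"
      by (metis residue_cases)
    then show ?thesis
      using residue_map_residue[of x] residue_map_residue[of y] residue_map_residue[of "x * y"]
        val_ge_mult_le[of x 0 y 0 0]
      by (auto simp: residue_mult_val_ge embed.hom_mult embed_val_ge_iff)
  qed
  interpret R: vector_space "\<lambda>a x. residue_map \<iota> a * x"
    by unfold_locales (auto simp: radd rmult hom1 algebra_simps)
  have "R.dim UNIV = 2"
    using unramified degree_two by (simp add: unramified_extension_def ext_degree_def)
  moreover have "R.dim UNIV = 1" if "range (residue_map \<iota>) = UNIV"
  proof -
    have "x \<in> R.span {1}" for x
      using that by (auto simp: R.span_singleton)
    then show ?thesis
      by (intro R.dim_unique[of "{1}"]) auto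
  qed
  ultimately obtain a where "a \<notin> range (residue_map \<iota>)" by fastforce
  then show ?thesis using that by (metis residue_cases)
qed

section \<open>Integral coordinates with respect to 1 and a residual generator\<close>

context
  fixes \<theta> assumes \<theta>: "\<theta> \<in> val_ge 0" "residue \<theta> \<notin> range (residue_map \<iota>)"
begin

text \<open>If \<open>b\<close> had valuation below \<open>k\<close>, division by
  \<open>\<iota> b\<close> would make \<open>\<theta>\<close> congruent to an element of L modulo
  the maximal ideal, contrary to the choice of its residue. Hence the valuation ring of K is free on
  1 and \<open>\<theta>\<close> over that of L, without any completeness.\<close>

lemma integral_coordinates:
  assumes "\<iota> a + \<iota> b * \<theta> \<in> val_ge k"
  shows "a \<in> val_ge k \<and> b \<in> val_ge k"
proof -
  have b: "b \<in> val_ge k"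
  proof (rule ccontr)
    assume nb: "b \<notin> val_ge k"
    then have b0: "b \<noteq> 0" and vb: "val b < k" by (auto simp: val_ge_def)
    have "(\<iota> a + \<iota> b * \<theta>) / \<iota> b \<in> val_ge 1"
      using assms b0 vb by (intro val_ge_divide[where j = k]) (auto simp: val_embed)
    then have m: "\<theta> - \<iota> (- (a / b)) \<in> val_ge 1"
      using b0 by (simp add: embed.hom_div embed.hom_uminus add_divide_distrib add.commute)
    then have "\<iota> (- (a / b)) \<in> val_ge 0"
      using val_ge_diff[OF \<theta>(1) val_ge_mono[OF m, of 0]] by simp
    then have "residue \<theta> = residue_map \<iota> (residue (- (a / b)))"
      using m \<theta>(1) by (subst residue_map_residue) (auto simp: embed_val_ge_iff residue_eq_iff_val_ge)
    then show False using \<theta>(2) by blast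
  qed
  then have "\<iota> b * \<theta> \<in> val_ge k"
    using val_ge_mult[of "\<iota> b" k \<theta> 0] \<theta>(1) by (simp add: embed_val_ge_iff)
  then have "\<iota> a \<in> val_ge k" using val_ge_diff[OF assms] by force
  then show ?thesis using b by (simp add: embed_val_ge_iff)
qed

text \<open>A linear relation between 1 and \<open>\<theta>\<close> has coefficients in every
  \<open>val_ge k\<close>, so they vanish; two independent vectors span a space of dimension
  2.\<close>

lemma coordinates: obtains a b where "x = \<iota> a + \<iota> b * \<theta>"
proof -
  interpret E: vector_space "\<lambda>a x. \<iota> a * x"
    by unfold_locales (auto simp: embed.hom_add embed.hom_mult algebra_simps)
  have dim2: "E.dim UNIV = 2"
    using degree_two by (simp add: ext_degree_def)
  \<comment> \<open>A nonzero \<open>dim\<close> is the cardinality of an actual basis, and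
    cardinality 2 makes that basis finite.\<close>
  obtain C where C: "E.independent C" "E.span C = UNIV" "card C = 2"
    using dim2 unfolding E.dim_def by (metis (mono_tags, lifting) E.span_UNIV someI_ex zero_neq_numeral)
  then interpret E: finite_dimensional_vector_space "\<lambda>a x. \<iota> a * x" C
    by unfold_locales (auto intro: card_ge_0_finite)
  have zero: "a = 0 \<and> b = 0" if "\<iota> a + \<iota> b * \<theta> = 0" for a b
    using that integral_coordinates[of a b] val_ge_eq_0 by (metis val_ge_0)
  have ne: "\<theta> \<noteq> 1"
  proof
    assume "\<theta> = 1"
    then show False using zero[of "-1" 1] by (simp add: embed.hom_uminus)
  qed
  have "\<theta> \<noteq> 0" using zero[of 0 1] by auto
  have indep: "E.independent {1, \<theta>}"
  proof (rule E.independent_insertI)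
    show "1 \<notin> E.span {\<theta>}"
    proof
      assume "1 \<in> E.span {\<theta>}"
      then obtain k where "1 = \<iota> k * \<theta>" by (auto simp: E.span_singleton)
      then show False using zero[of "-1" k] by (simp add: embed.hom_uminus)
    qed
  qed (use \<open>\<theta> \<noteq> 0\<close> in simp)
  have "E.span {1, \<theta>} = UNIV"
    using E.card_ge_dim_independent[of "{1, \<theta>}" UNIV] indep dim2 ne by auto
  then have "x \<in> E.span {1, \<theta>}" by simp
  then obtain a b where "x - \<iota> a * 1 = \<iota> b * \<theta>"
    by (auto simp: E.span_insert E.span_singleton)
  then have "x = \<iota> a + \<iota> b * \<theta>" by (simp add: algebra_simps)
  then show ?thesis by (rule that)
qed

text \<open>\<open>\<theta>\<close> and \<open>\<sigma> \<theta>\<close> are roots of the same monic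
  quadratic polynomial over L. They differ, since otherwise \<open>\<sigma>\<close> would be the
  identity, so their sum is the trace \<open>a\<close>, which is integral by
  \<open>integral_coordinates\<close>.\<close>

lemma conj_generator:
  obtains a where "a \<in> val_ge 0" "\<sigma> \<theta> = \<iota> a - \<theta>"
proof -
  obtain b a where ab: "\<theta> * \<theta> = \<iota> b + \<iota> a * \<theta>" by (rule coordinates)
  have "\<theta> * \<theta> \<in> val_ge 0" using val_ge_mult[OF \<theta>(1) \<theta>(1)] by simp
  then have a: "a \<in> val_ge 0" using integral_coordinates[of b a 0] ab by simp
  have "\<sigma> \<theta> * \<sigma> \<theta> = \<iota> b + \<iota> a * \<sigma> \<theta>"
    using arg_cong[OF ab, of \<sigma>] by (simp add: conj.hom_mult conj.hom_add conj_embed)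
  then have "(\<sigma> \<theta> - \<theta>) * (\<sigma> \<theta> + \<theta> - \<iota> a) = 0"
    using ab by (simp add: algebra_simps)
  moreover have "\<sigma> \<theta> \<noteq> \<theta>"
  proof
    assume eq: "\<sigma> \<theta> = \<theta>"
    have "\<sigma> x = x" for x
    proof -
      obtain a b where "x = \<iota> a + \<iota> b * \<theta>" by (rule coordinates)
      then show ?thesis by (simp add: conj.hom_mult conj.hom_add conj_embed eq)
    qed
    then show False using conj by (auto simp: conjugation_def)
  qed
  ultimately have "\<sigma> \<theta> + \<theta> - \<iota> a = 0" by simp
  then show ?thesis using that[OF a] by (simp add: algebra_simps)
qed

end

lemma conj_conj [simp]: "\<sigma> (\<sigma> x) = x"
proof -
  obtain \<theta> where t: "\<theta> \<in> val_ge 0" "residue \<theta> \<notin> range (residue_map \<iota>)" by (rule generator)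
  obtain a where a: "\<sigma> \<theta> = \<iota> a - \<theta>" using conj_generator[OF t] by metis
  obtain c d where "x = \<iota> c + \<iota> d * \<theta>" using coordinates[OF t] by metis
  then show ?thesis
    by (simp add: conj.hom_mult conj.hom_add conj.hom_minus conj_embed a)
qed

text \<open>For a valuation that splits in K this would fail. Here \<open>\<sigma>\<close> fixes the
  coordinates of \<open>x\<close> and sends \<open>\<theta>\<close> to an integral element, so it
  maps each \<open>val_ge k\<close> into itself; being an involution, it does so in both
  directions.\<close>

lemma conj_val_ge_iff: "\<sigma> x \<in> val_ge k \<longleftrightarrow> x \<in> val_ge k"
proof -
  obtain \<theta> where t: "\<theta> \<in> val_ge 0" "residue \<theta> \<notin> range (residue_map \<iota>)" by (rule generator)
  obtain a where a: "a \<in> val_ge 0" "\<sigma> \<theta> = \<iota> a - \<theta>" using conj_generator[OF t] by metis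
  have st: "\<sigma> \<theta> \<in> val_ge 0"
    unfolding a(2) using a(1) t(1) by (intro val_ge_diff) (simp_all add: embed_val_ge_iff)
  have *: "\<sigma> x \<in> val_ge k" if x: "x \<in> val_ge k" for x
  proof -
    obtain c d where cd: "x = \<iota> c + \<iota> d * \<theta>" using coordinates[OF t] by metis
    then have "c \<in> val_ge k" "d \<in> val_ge k" using integral_coordinates[OF t] x by auto
    then show ?thesis
      using st val_ge_mult[of "\<iota> d" k "\<sigma> \<theta>" 0]
      by (auto simp: cd conj.hom_mult conj.hom_add conj_embed embed_val_ge_iff intro!: val_ge_add)
  qed
  show ?thesis using *[of x] *[of "\<sigma> x"] by auto
qed

text \<open>If \<open>\<theta>\<close> and \<open>\<sigma> \<theta>\<close> were congruent, half of
  their sum \<open>\<iota> a\<close> would be an element of L congruent to \<open>\<theta>\<close>.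
  The resulting \<open>w\<close> shows that the residual conjugation is nontrivial and supplies a
  unit trace in the skew-hermitian case.\<close>

lemma non_residually_fixed: obtains w where "w \<in> val_ge 0" "w - \<sigma> w \<notin> val_ge 1"
proof -
  obtain \<theta> where t: "\<theta> \<in> val_ge 0" "residue \<theta> \<notin> range (residue_map \<iota>)" by (rule generator)
  obtain a where a: "a \<in> val_ge 0" "\<sigma> \<theta> = \<iota> a - \<theta>" using conj_generator[OF t] by metis
  have two: "(2::'k) \<noteq> 0" "val (2::'k) = 0"
    using odd_residue_char of_nat_val_ge[of 2] by (auto simp: val_ge_def)
  have "False" if "\<theta> - \<sigma> \<theta> \<in> val_ge 1"
  proof -
    have "(\<theta> - \<sigma> \<theta>) / 2 \<in> val_ge 1"
      using that two by (intro val_ge_divide) auto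
    moreover have "(\<theta> - \<sigma> \<theta>) / 2 = \<theta> - \<iota> (a / 2)"
      using two embed.hom_of_nat[of 2] by (simp add: a(2) embed.hom_div field_simps)
    ultimately have m: "\<theta> - \<iota> (a / 2) \<in> val_ge 1" by simp
    then have "\<iota> (a / 2) \<in> val_ge 0"
      using val_ge_diff[OF t(1) val_ge_mono[OF m, of 0]] by simp
    then have "residue \<theta> = residue_map \<iota> (residue (a / 2))"
      using m t(1) by (subst residue_map_residue) (auto simp: embed_val_ge_iff residue_eq_iff_val_ge)
    then show False using t(2) by blast
  qed
  then show ?thesis using that t(1) by blast
qed

section \<open>The induced conjugation of the residue field\<close>

definition residue_conj :: "'k residue_field \<Rightarrow> 'k residue_field" where
  "residue_conj a = residue (\<sigma> (SOME x. x \<in> val_ge 0 \<and> residue x = a))"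

text \<open>Two integral representatives differ by an element of the maximal ideal, which
  \<open>\<sigma>\<close> preserves, so the chosen representative does not matter.\<close>

lemma residue_conj_residue: "x \<in> val_ge 0 \<Longrightarrow> residue_conj (residue x) = residue (\<sigma> x)"
proof -
  assume x: "x \<in> val_ge 0"
  define y where "y = (SOME y. y \<in> val_ge 0 \<and> residue y = residue x)"
  have "y \<in> val_ge 0 \<and> residue y = residue x"
    unfolding y_def by (rule someI[of _ x]) (simp add: x)
  then have y: "y \<in> val_ge 0" "y - x \<in> val_ge 1"
    using x residue_eq_iff_val_ge[of y x] by auto
  then have "residue (\<sigma> y) = residue (\<sigma> x)"
    using x by (subst residue_eq_iff_val_ge)
      (auto simp: conj_val_ge_iff simp flip: conj.hom_minus)
  then show ?thesis by (simp add: residue_conj_def y_def)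
qed

lemma conjugation_residue_conj: "conjugation (residue_map \<iota>) residue_conj"
proof -
  have rc: "residue_conj (residue_conj a) = a" for a
  proof -
    obtain x where "x \<in> val_ge 0" "residue x = a" by (rule residue_cases)
    then show ?thesis
      using residue_conj_residue[of x] residue_conj_residue[of "\<sigma> x"]
      by (simp add: conj_val_ge_iff)
  qed
  have "field_hom residue_conj"
  proof unfold_locales
    show "residue_conj 0 = 0" "residue_conj 1 = 1"
      using residue_conj_residue[of 0] residue_conj_residue[of 1] by (simp_all add: residue_0 residue_1)
    fix a b :: "'k residue_field"
    obtain x y where xy: "x \<in> val_ge 0" "residue x = a" "y \<in> val_ge 0" "residue y = b"
      by (metis residue_cases)
    then show "residue_conj (a + b) = residue_conj a + residue_conj b"
      using residue_conj_residue[of x] residue_conj_residue[of y] residue_conj_residue[of "x + y"]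
      by (auto simp: residue_add_val_ge val_ge_add conj.hom_add conj_val_ge_iff)
    show "residue_conj (a * b) = residue_conj a * residue_conj b"
      using xy residue_conj_residue[of x] residue_conj_residue[of y] residue_conj_residue[of "x * y"]
        val_ge_mult_le[of x 0 y 0 0]
      by (auto simp: residue_mult_val_ge conj.hom_mult conj_val_ge_iff)
  qed
  moreover have "bij residue_conj" using rc by (rule involuntory_imp_bij)
  moreover have "residue_conj (residue_map \<iota> a) = residue_map \<iota> a" for a
  proof -
    obtain x where "x \<in> val_ge 0" "residue x = a" by (rule residue_cases)
    then show ?thesis
      using residue_map_residue[of x] residue_conj_residue[of "\<iota> x"]
      by (auto simp: embed_val_ge_iff conj_embed)
  qed
  moreover have "residue_conj \<noteq> id"
  proof
    assume id: "residue_conj = id"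
    obtain w where w: "w \<in> val_ge 0" "w - \<sigma> w \<notin> val_ge 1" by (rule non_residually_fixed)
    then have "residue w \<noteq> residue (\<sigma> w)" by (simp add: residue_eq_iff_val_ge conj_val_ge_iff)
    then show False using residue_conj_residue[of w] w by (simp add: id)
  qed
  ultimately show ?thesis by (simp add: conjugation_def)
qed

end

section \<open>Determinants and characteristic polynomials under reduction\<close>

text \<open>Reduction is a homomorphism only on the valuation ring, not on K. The Leibniz formula
  never leaves a subring \<open>S\<close>, so multiplicativity and additivity there suffice;
  \<open>S\<close> will be the polynomials with integral coefficients.\<close>

lemma det_partial_hom:
  fixes h :: "'a::comm_ring_1 \<Rightarrow> 'b::comm_ring_1"
  assumes S: "0 \<in> S" "1 \<in> S" "\<And>x. x \<in> S \<Longrightarrow> - x \<in> S"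
      "\<And>x y. x \<in> S \<Longrightarrow> y \<in> S \<Longrightarrow> x + y \<in> S" "\<And>x y. x \<in> S \<Longrightarrow> y \<in> S \<Longrightarrow> x * y \<in> S"
    and h: "h 0 = 0" "h 1 = 1" "\<And>x. x \<in> S \<Longrightarrow> h (- x) = - h x"
      "\<And>x y. x \<in> S \<Longrightarrow> y \<in> S \<Longrightarrow> h (x + y) = h x + h y"
      "\<And>x y. x \<in> S \<Longrightarrow> y \<in> S \<Longrightarrow> h (x * y) = h x * h y"
    and A: "A \<in> carrier_mat n n" "\<And>i j. i < n \<Longrightarrow> j < n \<Longrightarrow> A $$ (i, j) \<in> S"
  shows "det A \<in> S \<and> h (det A) = det (map_mat h A)"
proof -
  have sum: "sum g I \<in> S \<and> h (sum g I) = (\<Sum>i\<in>I. h (g i))"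
    if "\<And>i. i \<in> I \<Longrightarrow> g i \<in> S" for g :: "(nat \<Rightarrow> nat) \<Rightarrow> 'a" and I
    using that by (induction I rule: infinite_finite_induct) (auto simp: S h)
  have prod: "prod g I \<in> S \<and> h (prod g I) = (\<Prod>i\<in>I. h (g i))"
    if "\<And>i. i \<in> I \<Longrightarrow> g i \<in> S" for g :: "nat \<Rightarrow> 'a" and I
    using that by (induction I rule: infinite_finite_induct) (auto simp: S h)
  have sign: "signof p * x \<in> S \<and> h (signof p * x) = signof p * h x" if "x \<in> S" for p x
    using that by (auto simp: sign_def S h)
  have summand: "signof p * (\<Prod>i = 0..<n. A $$ (i, p i)) \<in> S \<and>
      h (signof p * (\<Prod>i = 0..<n. A $$ (i, p i))) =
        signof p * (\<Prod>i = 0..<n. map_mat h A $$ (i, p i))"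
    if p: "p permutes {0..<n}" for p
  proof -
    have pi: "i < n \<Longrightarrow> p i < n" for i using p permutes_in_image[of p "{0..<n}" i] by simp
    have "(\<Prod>i = 0..<n. A $$ (i, p i)) \<in> S \<and>
        h (\<Prod>i = 0..<n. A $$ (i, p i)) = (\<Prod>i = 0..<n. h (A $$ (i, p i)))"
      by (rule prod) (simp add: A pi)
    moreover have "(\<Prod>i = 0..<n. h (A $$ (i, p i))) = (\<Prod>i = 0..<n. map_mat h A $$ (i, p i))"
      using A(1) by (intro prod.cong) (auto simp: pi)
    ultimately show ?thesis using sign[of "\<Prod>i = 0..<n. A $$ (i, p i)" p] by simp
  qed
  have "det (map_mat h A) =
      (\<Sum>p | p permutes {0..<n}. signof p * (\<Prod>i = 0..<n. map_mat h A $$ (i, p i)))"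
    by (rule det_def') (simp add: A)
  also have "\<dots> = (\<Sum>p | p permutes {0..<n}. h (signof p * (\<Prod>i = 0..<n. A $$ (i, p i))))"
    using summand by (intro sum.cong) (simp_all del: index_map_mat)
  finally show ?thesis
    unfolding det_def'[OF A(1)]
    using sum[of "{p. p permutes {0..<n}}" "\<lambda>p. signof p * (\<Prod>i = 0..<n. A $$ (i, p i))"]
      conjunct1[OF summand]
    by simp
qed

text \<open>The blocks are given by an arbitrary index set, which avoids reordering the basis. In
  the Leibniz sum a permutation sending some index of \<open>S\<close> outside \<open>S\<close>
  contributes 0 on both sides; any other one permutes \<open>S\<close> by finiteness, hence also its
  complement, and never meets an erased entry.\<close>

lemma det_block_triangular_index:
  fixes A :: "'a::comm_ring_1 mat"
  assumes A: "A \<in> carrier_mat n n"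
    and tri: "\<And>i j. i < n \<Longrightarrow> j < n \<Longrightarrow> i \<in> S \<Longrightarrow> j \<notin> S \<Longrightarrow> A $$ (i, j) = 0"
  shows "det A = det (mat n n (\<lambda>(i, j). if i \<in> S \<longleftrightarrow> j \<in> S then A $$ (i, j) else 0))"
    (is "_ = det ?B")
proof -
  have B: "?B \<in> carrier_mat n n" by simp
  have "(\<Prod>i = 0..<n. A $$ (i, p i)) = (\<Prod>i = 0..<n. ?B $$ (i, p i))"
    if p: "p permutes {0..<n}" for p
  proof (cases "\<exists>i\<in>{0..<n}. i \<in> S \<and> p i \<notin> S")
    case True
    then obtain i where i: "i < n" "i \<in> S" "p i \<notin> S" by auto
    then have "p i < n" using p permutes_in_image[of p "{0..<n}" i] by simp
    then have "A $$ (i, p i) = 0" "?B $$ (i, p i) = 0" using i tri by auto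
    then have "(\<Prod>i = 0..<n. A $$ (i, p i)) = 0" "(\<Prod>i = 0..<n. ?B $$ (i, p i)) = 0"
      using i(1) by (auto intro!: prod_zero bexI[of _ i])
    then show ?thesis by simp
  next
    case False
    let ?S = "S \<inter> {0..<n}"
    have pi: "i < n \<Longrightarrow> p i < n" for i using p permutes_in_image[of p "{0..<n}" i] by simp
    have inj: "inj p" using p by (rule permutes_inj)
    have "p ` ?S \<subseteq> ?S" using False pi by auto
    then have S: "p ` ?S = ?S"
      by (intro endo_inj_surj) (auto intro: inj_on_subset[OF inj])
    have "i \<in> S \<longleftrightarrow> p i \<in> S" if "i < n" for i
    proof
      assume "p i \<in> S"
      then have "p i \<in> p ` ?S" using S pi[OF that] by auto
      then show "i \<in> S" using inj by (auto dest: injD)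
    qed (use False that in auto)
    then show ?thesis by (intro prod.cong) (auto simp: pi)
  qed
  then show ?thesis
    unfolding det_def'[OF A] det_def'[OF B] by (intro sum.cong) simp_all
qed

text \<open>Modulo the maximal ideal the matrix is block triangular, so its characteristic
  polynomial only depends on the diagonal blocks, that is, on the associated graded space.\<close>

lemma reduces_to_char_poly_blocks:
  fixes M :: "'k::discrete_valuation_field mat"
  assumes M: "M \<in> carrier_mat n n" "\<And>i j. i < n \<Longrightarrow> j < n \<Longrightarrow> M $$ (i, j) \<in> val_ge 0"
    and tri: "\<And>i j. i < n \<Longrightarrow> j < n \<Longrightarrow> i \<in> S \<Longrightarrow> j \<notin> S \<Longrightarrow> M $$ (i, j) \<in> val_ge 1"
  shows "reduces_to (char_poly M)
    (char_poly (mat n n (\<lambda>(i, j). if i \<in> S \<longleftrightarrow> j \<in> S then residue (M $$ (i, j)) else 0)))"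
proof -
  let ?N = "mat n n (\<lambda>(i, j). if i \<in> S \<longleftrightarrow> j \<in> S then residue (M $$ (i, j)) else 0)"
  let ?h = "map_poly residue :: 'k poly \<Rightarrow> _"
  let ?O = "{p :: 'k poly. \<forall>i. Polynomial.coeff p i \<in> val_ge 0}"
  let ?C = "char_poly_matrix M"
  have h: "Polynomial.coeff (?h p) i = residue (Polynomial.coeff p i)" for p i
    by (rule coeff_map_poly) (rule residue_0)
  have "det ?C \<in> ?O \<and> ?h (det ?C) = det (map_mat ?h ?C)"
  proof (rule det_partial_hom)
    show "p * q \<in> ?O" if "p \<in> ?O" "q \<in> ?O" for p q
      using that by (auto simp: coeff_mult intro!: val_ge_sum val_ge_mult_le[of _ 0 _ 0])
    show "?h (p * q) = ?h p * ?h q" if "p \<in> ?O" "q \<in> ?O" for p q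
      using that
      by (simp add: poly_eq_iff h coeff_mult residue_sum residue_mult_val_ge val_ge_mult_le[of _ 0 _ 0])
    show "?C \<in> carrier_mat n n" using M(1) by simp
    show "?C $$ (i, j) \<in> ?O" if "i < n" "j < n" for i j
      using that M by (auto simp: char_poly_matrix_def coeff_pCons val_ge_uminus val_ge_diff
          intro!: val_ge_add split: nat.splits)
    show "?h (p + q) = ?h p + ?h q" if "p \<in> ?O" "q \<in> ?O" for p q
      using that by (simp add: poly_eq_iff h residue_add_val_ge)
    show "?h (- p) = - ?h p" if "p \<in> ?O" for p
      using that by (simp add: poly_eq_iff h residue_uminus)
    show "?h 1 = 1" by (simp add: poly_eq_iff h residue_0 residue_1 coeff_1)
  qed (auto simp: val_ge_uminus val_ge_add coeff_1)
  moreover have "det (map_mat ?h ?C) =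
      det (mat n n (\<lambda>(i, j). if i \<in> S \<longleftrightarrow> j \<in> S then map_mat ?h ?C $$ (i, j) else 0))"
  proof (rule det_block_triangular_index)
    show "map_mat ?h ?C \<in> carrier_mat n n" using M(1) by simp
    show "map_mat ?h ?C $$ (i, j) = 0" if "i < n" "j < n" "i \<in> S" "j \<notin> S" for i j
    proof -
      have "i \<noteq> j" using that by auto
      moreover have "residue (- (M $$ (i, j))) = 0"
        using tri[OF that] M(2)[OF that(1,2)] by (simp add: residue_eq_0_iff val_ge_uminus)
      ultimately show ?thesis
        using that M(1) by (auto simp: char_poly_matrix_def poly_eq_iff h coeff_pCons residue_0 split: nat.splits)
    qed
  qed
  moreover have "mat n n (\<lambda>(i, j). if i \<in> S \<longleftrightarrow> j \<in> S then map_mat ?h ?C $$ (i, j) else 0)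
      = char_poly_matrix ?N"
    using M
    by (intro eq_matI)
      (auto simp: char_poly_matrix_def poly_eq_iff h coeff_pCons residue_0 residue_1 residue_uminus
        residue_add_val_ge val_ge_uminus split: nat.splits)
  ultimately show ?thesis
    by (simp add: reduces_to_def char_poly_def valuation_ring_eq_val_ge)
qed

section \<open>Independence of the characteristic polynomial from the basis\<close>

definition transition ::
    "('e::field \<Rightarrow> 'v::ab_group_add \<Rightarrow> 'v) \<Rightarrow> 'v list \<Rightarrow> 'v list \<Rightarrow> ('v \<Rightarrow> 'v) \<Rightarrow> 'e mat" where
  "transition sc bs cs T =
     mat (length bs) (length cs)
       (\<lambda>(i, j). Modules.module.representation sc (set bs) (T (cs ! j)) (bs ! i))"

context vector_space
begin

lemma ordered_basisD:
  assumes "ordered_basis scale bs"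
  shows "distinct bs" "independent (set bs)" "span (set bs) = UNIV"
proof -
  from assms interpret F: finite_dimensional_vector_space scale "set bs"
    by (simp add: ordered_basis_def)
  show "independent (set bs)" "span (set bs) = UNIV" "distinct bs"
    using F.independent_Basis F.span_Basis assms by (simp_all add: ordered_basis_def)
qed

lemma ordered_basisI:
  "distinct bs \<Longrightarrow> independent (set bs) \<Longrightarrow> span (set bs) = UNIV \<Longrightarrow> ordered_basis scale bs"
  by (auto simp: ordered_basis_def intro!: finite_dimensional_vector_space.intro
      finite_dimensional_vector_space_axioms.intro vector_space_axioms)

text \<open>One composition law covers both matrices of endomorphisms and base changes (the case of
  \<open>id\<close>), so conjugation by a base change is a matter of rewriting.\<close>

lemma transition_mult:
  assumes bs: "ordered_basis scale bs" and cs: "ordered_basis scale cs"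
    and T: "Vector_Spaces.linear scale scale T"
  shows "transition scale bs cs T * transition scale cs ds U = transition scale bs ds (T \<circ> U)"
proof (rule eq_matI)
  fix i j
  assume "i < dim_row (transition scale bs ds (T \<circ> U))" "j < dim_col (transition scale bs ds (T \<circ> U))"
  then have i: "i < length bs" and j: "j < length ds" by (simp_all add: transition_def)
  let ?r = "\<lambda>v. representation (set bs) v (bs ! i)"
  let ?c = "representation (set cs) (U (ds ! j))"
  interpret r: Vector_Spaces.linear scale "(*)" ?r
    by (rule linear_representation) (use ordered_basisD[OF bs] in auto)
  interpret T: Vector_Spaces.linear scale scale T by (rule T)
  have "U (ds ! j) = (\<Sum>v\<in>set cs. scale (?c v) v)"
    using ordered_basisD[OF cs] by (simp add: sum_representation_eq)
  also have "\<dots> = (\<Sum>k = 0..<length cs. scale (?c (cs ! k)) (cs ! k))"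
    using ordered_basisD(1)[OF cs]
    by (subst sum.reindex_bij_betw[symmetric, OF bij_betw_nth, of cs "{0..<length cs}"]) auto
  finally have "?r (T (U (ds ! j))) = ?r (T (\<Sum>k = 0..<length cs. scale (?c (cs ! k)) (cs ! k)))"
    by (rule arg_cong)
  also have "\<dots> = (\<Sum>k = 0..<length cs. ?c (cs ! k) * ?r (T (cs ! k)))"
    by (simp add: T.sum T.scale r.sum r.scale)
  finally show "(transition scale bs cs T * transition scale cs ds U) $$ (i, j) = transition scale bs ds (T \<circ> U) $$ (i, j)"
    using i j by (simp add: transition_def scalar_prod_def mult.commute)
qed (simp_all add: transition_def)

lemma transition_id:
  assumes "ordered_basis scale bs"
  shows "transition scale bs bs id = 1\<^sub>m (length bs)"
  using ordered_basisD[OF assms]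
  by (intro eq_matI) (auto simp: transition_def representation_basis nth_eq_iff_index_eq)

text \<open>Base change makes the matrix in the basis picked by \<open>SOME\<close> similar to the
  one in \<open>bs\<close>.\<close>

lemma endo_char_poly_eq:
  assumes bs: "ordered_basis scale bs" and T: "Vector_Spaces.linear scale scale T"
  shows "endo_char_poly scale T = char_poly (matrix_of scale bs T)"
proof -
  define cs where "cs = (SOME bs. ordered_basis scale bs)"
  have cs: "ordered_basis scale cs" unfolding cs_def using bs by (rule someI)
  have len: "length cs = length bs"
  proof -
    interpret F: finite_dimensional_vector_space scale "set bs"
      using bs by (simp add: ordered_basis_def)
    have "card (set cs) = card (set bs)"
      using ordered_basisD[OF cs] ordered_basisD[OF bs] basis_card_eq_dim by (metis subset_UNIV order_refl)
    then show ?thesis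
      using ordered_basisD(1)[OF cs] ordered_basisD(1)[OF bs] by (simp add: distinct_card)
  qed
  have id: "Vector_Spaces.linear scale scale id" by (rule linear_id)
  have "matrix_of scale cs T = transition scale cs bs id * transition scale bs bs T * transition scale bs cs id"
    using T by (simp add: transition_mult cs bs id linear_compose) (simp add: matrix_of_def transition_def)
  moreover have "transition scale cs bs id * transition scale bs cs id = 1\<^sub>m (length bs)"
      "transition scale bs cs id * transition scale cs bs id = 1\<^sub>m (length bs)"
    by (simp_all add: transition_mult cs bs id transition_id len)
  ultimately have "similar_mat (matrix_of scale cs T) (transition scale bs bs T)"
    by (intro similar_matI[of _ _ "transition scale cs bs id" "transition scale bs cs id" "length bs"])
      (auto simp: transition_def matrix_of_def len)
  then have "char_poly (matrix_of scale cs T) = char_poly (transition scale bs bs T)"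
    by (rule char_poly_similar)
  then show ?thesis by (simp add: endo_char_poly_def cs_def matrix_of_def transition_def)
qed

end

section \<open>Torsion elements congruent to the identity\<close>

text \<open>Models the multiples of a lattice by the powers of the maximal ideal. That the lattice
  spans the space is \<open>exhaustive\<close>; that it contains no line is
  \<open>separated\<close>.\<close>

locale filtered_space = vector_space sc
  for sc :: "'k::discrete_valuation_field \<Rightarrow> 'v::ab_group_add \<Rightarrow> 'v" +
  fixes \<Lambda> :: "int \<Rightarrow> 'v set"
  assumes zero_mem: "0 \<in> \<Lambda> k"
    and add_mem: "x \<in> \<Lambda> k \<Longrightarrow> y \<in> \<Lambda> k \<Longrightarrow> x + y \<in> \<Lambda> k"
    and scale_mem: "a \<in> val_ge j \<Longrightarrow> x \<in> \<Lambda> k \<Longrightarrow> sc a x \<in> \<Lambda> (j + k)"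
    and separated: "(\<And>k. x \<in> \<Lambda> k) \<Longrightarrow> x = 0"
    and exhaustive: "\<exists>k. x \<in> \<Lambda> k"
begin

lemma mono_mem: "x \<in> \<Lambda> j \<Longrightarrow> k \<le> j \<Longrightarrow> x \<in> \<Lambda> k"
  using scale_mem[of 1 "k - j" x j] val_ge_mono[OF val_ge_1, of "k - j"] by simp

lemma sum_mem: "(\<And>i. i \<in> A \<Longrightarrow> g i \<in> \<Lambda> k) \<Longrightarrow> sum g A \<in> \<Lambda> k"
  by (induction A rule: infinite_finite_induct) (auto intro: zero_mem add_mem)

lemma binomial_iterate:
  assumes h: "Vector_Spaces.linear sc sc h"
  shows "((\<lambda>v. v + h v) ^^ m) v = (\<Sum>k\<le>m. sc (of_nat (m choose k)) ((h ^^ k) v))"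
proof (induction m)
  case (Suc m)
  interpret h: Vector_Spaces.linear sc sc h by (rule h)
  let ?u = "\<lambda>m k. sc (of_nat (m choose k)) ((h ^^ k) v)"
  \<comment> \<open>The added term has binomial coefficient 0; it aligns the ranges for Pascal's
    rule.\<close>
  have "(\<Sum>k\<le>m. ?u m k) = (\<Sum>k\<le>Suc m. ?u m k)"
    by (simp add: binomial_eq_0)
  also have "\<dots> = v + (\<Sum>k\<le>m. sc (of_nat (m choose Suc k)) ((h ^^ Suc k) v))"
    by (subst sum.atMost_Suc_shift) simp
  finally have 1: "(\<Sum>k\<le>m. ?u m k) = v + (\<Sum>k\<le>m. sc (of_nat (m choose Suc k)) ((h ^^ Suc k) v))" .
  have 2: "h (\<Sum>k\<le>m. ?u m k) = (\<Sum>k\<le>m. sc (of_nat (m choose k)) ((h ^^ Suc k) v))"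
    by (simp add: h.sum h.scale)
  have step: "((\<lambda>v. v + h v) ^^ Suc m) v = (\<Sum>k\<le>m. ?u m k) + h (\<Sum>k\<le>m. ?u m k)"
    using Suc by simp
  have "(\<Sum>k\<le>Suc m. ?u (Suc m) k) = v + (\<Sum>k\<le>m. ?u (Suc m) (Suc k))"
    by (subst sum.atMost_Suc_shift) simp
  also have "\<dots> = (v + (\<Sum>k\<le>m. sc (of_nat (m choose Suc k)) ((h ^^ Suc k) v)))
      + (\<Sum>k\<le>m. sc (of_nat (m choose k)) ((h ^^ Suc k) v))"
    by (simp add: scale_left_distrib sum.distrib add.assoc add.commute)
  finally show ?case unfolding step 2 unfolding 1 by (rule sym)
qed simp

text \<open>Here \<open>h\<close> is nilpotent of order two modulo the maximal ideal, which is all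
  that a two-step filtration gives. The price is the factor 2 in \<open>small\<close>.\<close>

context
  fixes h :: "'v \<Rightarrow> 'v" and p :: nat
  assumes h: "Vector_Spaces.linear sc sc h"
    and h_mem: "\<And>k v. v \<in> \<Lambda> k \<Longrightarrow> h v \<in> \<Lambda> k"
    and h_sq_mem: "\<And>k v. v \<in> \<Lambda> k \<Longrightarrow> h (h v) \<in> \<Lambda> (k + 1)"
    and p: "prime p" "(of_nat p :: 'k) \<noteq> 0"
    and small: "val (of_nat p :: 'k) = 0 \<or> 2 * val (of_nat p :: 'k) < int p - 1"
begin

lemma pow_mem: "v \<in> \<Lambda> k \<Longrightarrow> (h ^^ m) v \<in> \<Lambda> k"
  by (induction m) (auto intro: h_mem)

lemma even_pow_mem: "v \<in> \<Lambda> k \<Longrightarrow> (h ^^ (2 * m)) v \<in> \<Lambda> (k + int m)"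
proof (induction m)
  case (Suc m)
  then show ?case using h_sq_mem[of "(h ^^ (2 * m)) v" "k + int m"] by (simp add: add.commute add.left_commute)
qed simp

text \<open>The hypothesis \<open>rel\<close> is \<open>((1 + h)\<^sup>p - 1) / h\<close> applied to \<open>w\<close>.\<close>

lemma improve:
  assumes rel: "(\<Sum>k<p. sc (of_nat (p choose Suc k)) ((h ^^ k) w)) = 0"
    and w: "w \<in> \<Lambda> j" "h w \<in> \<Lambda> (j + 1)"
  shows "w \<in> \<Lambda> (j + 1)"
proof -
  define e where "e = val (of_nat p :: 'k)"
  have e0: "0 \<le> e" using of_nat_val_ge[of p, where 'a = 'k] p(2) by (simp add: val_ge_def e_def)
  have p1: "1 < p" using p(1) by (rule prime_gt_1_nat)
  \<comment> \<open>All terms of \<open>rel\<close> except \<open>p w\<close>, the one for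
    \<open>k = 0\<close>, lie \<open>e + 1\<close> steps deeper than \<open>j\<close>; hence so does
    \<open>p w\<close>, and dividing by \<open>p\<close> costs only \<open>e\<close> steps.\<close>
  have "sc (of_nat (p choose Suc k)) ((h ^^ k) w) \<in> \<Lambda> (e + (j + 1))" if k: "k \<in> {1..<p}" for k
  proof -
    obtain k' where k': "k = Suc k'" using k by (cases k) auto
    have hk: "(h ^^ k) w \<in> \<Lambda> (j + 1)"
      using pow_mem[OF w(2), of k'] by (simp add: k' funpow_swap1)
    show ?thesis
    proof (cases "Suc k < p")
      case True
      then have "p dvd p choose Suc k" using p by (intro dvd_choose_prime) auto
      then obtain c where "p choose Suc k = p * c" by (rule dvdE)
      then have "(of_nat (p choose Suc k) :: 'k) \<in> val_ge e"
        by (auto simp: e_def intro!: val_ge_mult_le[OF val_ge_self of_nat_val_ge])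
      then show ?thesis using hk by (rule scale_mem)
    next
      case False
      then have kp: "Suc k = p" using k by auto
      have "(h ^^ k) w \<in> \<Lambda> (e + (j + 1))"
      proof (cases "e = 0")
        case True
        then show ?thesis using hk by simp
      next
        case False
        then have e: "1 \<le> e" "2 * e < int p - 1" using small e0 by (auto simp: e_def)
        then have "p \<noteq> 2" by auto
        then have "odd p" using p(1) p1 by (intro prime_odd_nat) auto
        \<comment> \<open>The last term has coefficient 1, so the gain must come from
          \<open>h\<close> alone. As \<open>p\<close> is odd, \<open>k = p - 1\<close> is even and
          the strict bound \<open>2 e < p - 1\<close> improves by a whole 2: there are enough pairs
          of factors \<open>h\<close> to gain \<open>e + 1\<close> steps.\<close>
        then have "2 * (e + 1) \<le> int k" using e kp by presburger
        then have "int (2 * nat (e + 1)) \<le> int k" using e by simp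
        then have le: "2 * nat (e + 1) \<le> k" by (simp only: of_nat_le_iff)
        have "(h ^^ (2 * nat (e + 1))) w \<in> \<Lambda> (j + int (nat (e + 1)))"
          using w(1) by (rule even_pow_mem)
        then have "(h ^^ (k - 2 * nat (e + 1))) ((h ^^ (2 * nat (e + 1))) w) \<in> \<Lambda> (j + int (nat (e + 1)))"
          by (rule pow_mem)
        then show ?thesis
          using le e by (simp add: funpow_add[THEN fun_cong, unfolded o_apply, symmetric] algebra_simps)
      qed
      then show ?thesis by (simp add: kp)
    qed
  qed
  then have "(\<Sum>k\<in>{1..<p}. sc (of_nat (p choose Suc k)) ((h ^^ k) w)) \<in> \<Lambda> (e + (j + 1))"
    by (rule sum_mem)
  moreover have "(\<Sum>k<p. sc (of_nat (p choose Suc k)) ((h ^^ k) w)) =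
      sc (of_nat p) w + (\<Sum>k\<in>{1..<p}. sc (of_nat (p choose Suc k)) ((h ^^ k) w))"
    using p1 by (simp add: lessThan_atLeast0 sum.atLeast_Suc_lessThan)
  ultimately have "- sc (of_nat p) w \<in> \<Lambda> (e + (j + 1))"
    using rel by (simp add: minus_unique)
  then have "sc (- 1) (- sc (of_nat p) w) \<in> \<Lambda> (0 + (e + (j + 1)))"
    by (intro scale_mem) (simp_all add: val_ge_uminus)
  then have pw: "sc (of_nat p) w \<in> \<Lambda> (e + (j + 1))" by simp
  have "inverse (of_nat p) \<in> (val_ge (- e) :: 'k set)"
    using p(2) by (simp add: e_def val_ge_def val_inverse)
  from scale_mem[OF this pw] show ?thesis using p(2) by simp
qed

text \<open>The relation holds on the whole image of \<open>h\<close>, so \<open>improve\<close> can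
  be iterated there: \<open>h v\<close> sinks arbitrarily deep and vanishes by
  separatedness.\<close>

lemma torsion_trivial:
  assumes tors: "\<And>v. ((\<lambda>v. v + h v) ^^ p) v = v"
  shows "h v = 0"
proof -
  interpret h: Vector_Spaces.linear sc sc h by (rule h)
  have rel: "(\<Sum>k<p. sc (of_nat (p choose Suc k)) ((h ^^ k) (h v))) = 0" for v
  proof -
    have "v = (\<Sum>k\<le>p. sc (of_nat (p choose k)) ((h ^^ k) v))"
      using binomial_iterate[OF h, of p v] tors[of v] by simp
    also have "\<dots> = v + (\<Sum>k<p. sc (of_nat (p choose Suc k)) ((h ^^ Suc k) v))"
      by (simp add: sum.atMost_shift)
    finally show ?thesis by (simp add: funpow_swap1)
  qed
  have *: "h v \<in> \<Lambda> (j + int i)" if "v \<in> \<Lambda> j" for i j v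
    using that
  proof (induction i arbitrary: v j)
    case (Suc i)
    have hv: "h v \<in> \<Lambda> (j + int i)" using Suc by blast
    \<comment> \<open>\<open>improve\<close> requires \<open>h w\<close> to be one step deeper than
      \<open>w\<close>. This is known for \<open>w = h (h v)\<close> through
      \<open>h_sq_mem\<close>, and the conclusion then provides it for
      \<open>w = h v\<close>.\<close>
    have "h (h v) \<in> \<Lambda> (j + int i + 1)"
    proof (rule improve)
      show "h (h v) \<in> \<Lambda> (j + int i)" using hv by (rule h_mem)
      show "h (h (h v)) \<in> \<Lambda> (j + int i + 1)" using hv by (rule h_sq_mem)
    qed (rule rel)
    then have "h v \<in> \<Lambda> (j + int i + 1)" using improve[OF rel hv] by blast
    then show ?case by (simp add: algebra_simps)
  qed (simp add: h_mem)
  obtain j where j: "v \<in> \<Lambda> j" using exhaustive by blast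
  show ?thesis
  proof (rule separated)
    show "h v \<in> \<Lambda> k" for k
      using *[OF j, of "nat (k - j)"] by (rule mono_mem) simp
  qed
qed

end

end

section \<open>Orthogonal bases of lattices in hermitian spaces\<close>

text \<open>The module generated by \<open>S\<close> over the valuation ring; the inductive form
  lets properties pass from generators to the lattice one summand at a time.\<close>

inductive_set lattice_hull ::
  "('k::discrete_valuation_field \<Rightarrow> 'v::ab_group_add \<Rightarrow> 'v) \<Rightarrow> 'v set \<Rightarrow> 'v set"
  for sc and S where
    zero: "0 \<in> lattice_hull sc S"
  | add_gen: "a \<in> val_ge 0 \<Longrightarrow> s \<in> S \<Longrightarrow> x \<in> lattice_hull sc S \<Longrightarrow> sc a s + x \<in> lattice_hull sc S"

lemma lattice_hull_add:
  "x \<in> lattice_hull sc S \<Longrightarrow> y \<in> lattice_hull sc S \<Longrightarrow> x + y \<in> lattice_hull sc S"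
  by (induction rule: lattice_hull.induct) (auto simp: add.assoc intro: lattice_hull.intros)

lemma lattice_hull_scale:
  assumes "vector_space sc" and "x \<in> lattice_hull sc S" and c: "c \<in> val_ge 0"
  shows "sc c x \<in> lattice_hull sc S"
proof -
  interpret vector_space sc by (rule assms(1))
  show ?thesis
    using assms(2)
  proof (induction rule: lattice_hull.induct)
    case (add_gen a s x)
    then show ?case
      using val_ge_mult[of c 0 a 0] c by (simp add: scale_right_distrib lattice_hull.add_gen)
  qed (simp add: lattice_hull.zero)
qed

lemma lattice_hull_base:
  assumes "vector_space sc" and "s \<in> S"
  shows "s \<in> lattice_hull sc S"
proof -
  interpret vector_space sc by (rule assms(1))
  show ?thesis using lattice_hull.add_gen[of 1 s S 0 sc] assms(2) by (simp add: lattice_hull.zero)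
qed

text \<open>The sign \<open>\<epsilon>\<close> treats the hermitian and the skew-hermitian case at once.\<close>

locale hermitian_space =
  unramified_quadratic \<iota> \<sigma> + finite_dimensional_vector_space sc B
  for \<iota> :: "'l::discrete_valuation_field \<Rightarrow> 'k::discrete_valuation_field" and \<sigma>
    and sc :: "'k \<Rightarrow> 'v::ab_group_add \<Rightarrow> 'v" and B +
  fixes f :: "'v \<Rightarrow> 'v \<Rightarrow> 'k" and \<epsilon> :: 'k
  assumes sesq: "sesquilinear UNIV sc \<sigma> f"
    and herm: "f y x = \<epsilon> * \<sigma> (f x y)"
    and sign: "\<epsilon> = 1 \<or> \<epsilon> = - 1"
    and nondeg: "(\<And>y. f x y = 0) \<Longrightarrow> x = 0"
begin

lemma f_add_left: "f (x + y) z = f x z + f y z" and f_add_right: "f x (y + z) = f x y + f x z"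
  and f_scale_left: "f (sc a x) y = a * f x y" and f_scale_right: "f x (sc a y) = \<sigma> a * f x y"
  using sesq by (simp_all add: sesquilinear_def)

lemma f_zero_left [simp]: "f 0 y = 0" and f_zero_right [simp]: "f x 0 = 0"
  using f_scale_left[of 0 0 y] f_scale_right[of x 0 0] by simp_all

lemma f_diff_left: "f (x - y) z = f x z - f y z"
  using f_add_left[of "x - y" y z] by simp

lemma f_sum_left: "f (sum g A) y = (\<Sum>i\<in>A. f (g i) y)"
  by (induction A rule: infinite_finite_induct) (simp_all add: f_add_left)

lemma f_sum_right: "f x (sum g A) = (\<Sum>i\<in>A. f x (g i))"
  by (induction A rule: infinite_finite_induct) (simp_all add: f_add_right)

lemma f_swap_val_ge: "f x y \<in> val_ge k \<longleftrightarrow> f y x \<in> val_ge k"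
proof -
  have "f y x = \<sigma> (f x y) \<or> f y x = - \<sigma> (f x y)" using herm[of y x] sign by auto
  then show ?thesis
    using conj_val_ge_iff[of "f x y" k] val_ge_uminus[of "\<sigma> (f x y)" k]
      val_ge_uminus[of "- \<sigma> (f x y)" k]
    by auto
qed

lemma f_swap_eq_0: "f x y = 0 \<longleftrightarrow> f y x = 0"
  using val_ge_eq_0 f_swap_val_ge by (metis val_ge_0)

lemma orthogonal_independent:
  assumes "\<And>x y. x \<in> X \<Longrightarrow> y \<in> X \<Longrightarrow> x \<noteq> y \<Longrightarrow> f x y = 0" "\<And>x. x \<in> X \<Longrightarrow> f x x \<noteq> 0"
  shows "independent X"
  unfolding independent_explicit_module
proof (intro allI impI)
  fix t u v
  assume t: "finite t" "t \<subseteq> X" "(\<Sum>v\<in>t. sc (u v) v) = 0" "v \<in> t"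
  then have "0 = f (\<Sum>v\<in>t. sc (u v) v) v" by simp
  also have "\<dots> = (\<Sum>w\<in>t. u w * f w v)" by (simp add: f_sum_left f_scale_left)
  also have "\<dots> = (\<Sum>w\<in>t. if w = v then u v * f v v else 0)"
    using t assms(1) by (intro sum.cong) auto
  also have "\<dots> = u v * f v v" using t by simp
  finally show "u v = 0" using assms(2)[of v] t by auto
qed

text \<open>Polarisation: \<open>f (x + c y) (x + c y)\<close> involves the \<open>\<epsilon>\<close>-trace of \<open>\<sigma> c * f x y\<close>, and the
  \<open>\<epsilon>\<close>-trace of the valuation ring contains a unit.\<close>

lemma exists_anisotropic_minimal:
  assumes W: "\<And>u v. u \<in> W \<Longrightarrow> v \<in> W \<Longrightarrow> u + v \<in> W"
      "\<And>c u. c \<in> val_ge 0 \<Longrightarrow> u \<in> W \<Longrightarrow> sc c u \<in> W"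
    and xy: "x \<in> W" "y \<in> W" "f x y \<noteq> 0"
    and min: "\<And>u v. u \<in> W \<Longrightarrow> v \<in> W \<Longrightarrow> f u v \<in> val_ge (val (f x y))"
  obtains z where "z \<in> W" "f z z \<noteq> 0" "val (f z z) = val (f x y)"
proof (rule ccontr)
  note thesisI = that
  assume "\<not> thesis"
  define k where "k = val (f x y)"
  have big: "f z z \<in> val_ge (k + 1)" if "z \<in> W" for z
  proof (cases "f z z = 0")
    case False
    then have "k \<le> val (f z z)" using min[OF \<open>z \<in> W\<close> \<open>z \<in> W\<close>] by (simp add: val_ge_def k_def)
    moreover have "val (f z z) \<noteq> k" using thesisI[OF \<open>z \<in> W\<close> False] \<open>\<not> thesis\<close> by (auto simp: k_def)
    ultimately show ?thesis by (simp add: val_ge_def)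
  qed simp
  \<comment> \<open>An element of unit \<open>\<epsilon>\<close>-trace: 1 has trace 2 in the
    hermitian case, and \<open>non_residually_fixed\<close> serves the skew-hermitian one.\<close>
  obtain w where w: "w \<in> val_ge 0" "w + \<epsilon> * \<sigma> w \<notin> val_ge 1"
  proof (cases "\<epsilon> = 1")
    case True
    then show ?thesis using that[of 1] odd_residue_char by simp
  next
    case False
    then show ?thesis using sign non_residually_fixed that by auto
  qed
  obtain \<pi> :: 'k where \<pi>: "\<pi> \<noteq> 0" "val \<pi> = 1" "\<sigma> \<pi> = \<pi>" by (rule uniformizer)
  define q where "q = \<pi> powi k"
  have q: "q \<noteq> 0" "val q = k" using \<pi> by (simp_all add: q_def val_power_int)
  have sq: "\<sigma> q = q"
    using \<pi> by (simp add: q_def power_int_def conj.hom_power conj.hom_inverse)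
  \<comment> \<open>Chosen so that the cross terms of \<open>f (x + c y) (x + c y)\<close> add up to
    the \<open>\<epsilon>\<close>-trace of \<open>w\<close> times \<open>q\<close>, of valuation
    exactly \<open>k\<close>. Integrality of \<open>c\<close> uses that \<open>q\<close> and
    \<open>f x y\<close> have the same valuation.\<close>
  define c where "c = \<sigma> (w * q / f x y)"
  have c: "c \<in> val_ge 0"
    unfolding c_def conj_val_ge_iff
    using w(1) xy(3) val_ge_mult[OF w(1) val_ge_self[of q]] q
    by (intro val_ge_divide[where j = k]) (auto simp: k_def)
  have t: "\<sigma> c * f x y = w * q" using xy(3) by (simp add: c_def)
  have "c * f y x = \<epsilon> * \<sigma> (\<sigma> c * f x y)" using herm[of y x] by (simp add: conj.hom_mult)
  then have t': "c * f y x = \<epsilon> * (\<sigma> w * q)" by (simp add: t conj.hom_mult sq)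
  have cy: "sc c y \<in> W" using W(2) c xy by blast
  have "f (x + sc c y) (x + sc c y) - f x x - f (sc c y) (sc c y) \<in> val_ge (k + 1)"
    using W(1)[OF xy(1) cy] big xy(1) cy by (intro val_ge_diff) auto
  also have "f (x + sc c y) (x + sc c y) - f x x - f (sc c y) (sc c y) = \<sigma> c * f x y + c * f y x"
    by (simp add: f_add_left f_add_right f_scale_left f_scale_right algebra_simps)
  also have "\<dots> = (w + \<epsilon> * \<sigma> w) * q" by (simp add: t t' algebra_simps)
  finally have "(w + \<epsilon> * \<sigma> w) * q / q \<in> val_ge 1"
    using q by (intro val_ge_divide[where j = "k + 1"]) auto
  then show False using w(2) q by simp
qed

text \<open>Gram-Schmidt over the valuation ring: a maximal orthogonal family that splits off from
  \<open>T\<close> is taken, and a nonzero complement \<open>W\<close> would contain an anisotropic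
  vector of least valuation by which to enlarge it.\<close>

lemma lattice_orthogonal_basis:
  assumes T: "0 \<in> T" "\<And>x y. x \<in> T \<Longrightarrow> y \<in> T \<Longrightarrow> x + y \<in> T"
      "\<And>a x. a \<in> val_ge 0 \<Longrightarrow> x \<in> T \<Longrightarrow> sc a x \<in> T"
    and spanning: "span T = UNIV"
    and bounded: "\<And>x y. x \<in> T \<Longrightarrow> y \<in> T \<Longrightarrow> f x y \<in> val_ge N"
  obtains X where "X \<subseteq> T" "finite X" "card X = dimension"
    "\<And>x y. x \<in> X \<Longrightarrow> y \<in> X \<Longrightarrow> x \<noteq> y \<Longrightarrow> f x y = 0" "\<And>x. x \<in> X \<Longrightarrow> f x x \<noteq> 0"
    "\<And>x t. x \<in> X \<Longrightarrow> t \<in> T \<Longrightarrow> f t x / f x x \<in> val_ge 0"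
proof -
  \<comment> \<open>The last condition says that orthogonal projection to each line of
    \<open>X\<close> has integral coefficients on \<open>T\<close>, so that \<open>pr\<close> keeps
    \<open>T\<close> inside itself.\<close>
  define good where "good X \<longleftrightarrow> X \<subseteq> T \<and> finite X \<and>
      (\<forall>x\<in>X. \<forall>y\<in>X. x \<noteq> y \<longrightarrow> f x y = 0) \<and> (\<forall>x\<in>X. f x x \<noteq> 0) \<and>
      (\<forall>x\<in>X. \<forall>t\<in>T. f t x / f x x \<in> val_ge 0)" for X
  have indep: "independent X" if "good X" for X
    using that by (intro orthogonal_independent) (auto simp: good_def)
  have "card X \<le> dimension" if "good X" for X
    using independent_card_le_dim[OF subset_UNIV indep[OF that]] by (simp add: dimension_def)
  moreover have "good {}" by (simp add: good_def)
  ultimately obtain X where X: "good X" and max: "\<And>Y. good Y \<Longrightarrow> card Y \<le> card X"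
    using ex_has_greatest_nat[of good "{}" card "Suc dimension"] by (metis less_Suc_eq_le)
  define W where "W = {t \<in> T. \<forall>x\<in>X. f t x = 0}"
  define pr where "pr t = t - (\<Sum>x\<in>X. sc (f t x / f x x) x)" for t
  have neg: "- x \<in> T" if "x \<in> T" for x
    using T(3)[of "- 1" x] that by (simp add: val_ge_uminus)
  have sumT: "sum g A \<in> T" if "\<And>i. i \<in> A \<Longrightarrow> g i \<in> T" for g :: "'v \<Rightarrow> 'v" and A
    using that by (induction A rule: infinite_finite_induct) (auto intro: T)
  have f_proj: "f (\<Sum>x\<in>X. sc (f t x / f x x) x) y = f t y" if y: "y \<in> X" for t y
  proof -
    have "f (\<Sum>x\<in>X. sc (f t x / f x x) x) y = (\<Sum>x\<in>X. f t x / f x x * f x y)"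
      by (simp add: f_sum_left f_scale_left)
    also have "\<dots> = (\<Sum>x\<in>X. if x = y then f t y else 0)"
      using X y by (intro sum.cong) (auto simp: good_def)
    finally show ?thesis using X y by (simp add: good_def)
  qed
  have prW: "pr t \<in> W" if t: "t \<in> T" for t
  proof -
    have "(\<Sum>x\<in>X. sc (f t x / f x x) x) \<in> T"
      using X t by (intro sumT T(3)) (auto simp: good_def)
    then have "pr t \<in> T" using T(2)[OF t neg] by (simp add: pr_def)
    then show ?thesis by (simp add: W_def pr_def f_diff_left f_proj)
  qed
  have W_pr: "f w (pr t) = f w t" if "w \<in> W" for w t
  proof -
    have "f w t = f w (pr t) + f w (\<Sum>x\<in>X. sc (f t x / f x x) x)"
      by (simp add: pr_def flip: f_add_right)
    also have "f w (\<Sum>x\<in>X. sc (f t x / f x x) x) = 0"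
      using that by (simp add: f_sum_right f_scale_right W_def)
    finally show ?thesis by simp
  qed
  have W_zero: "W \<subseteq> {0}"
  proof (rule ccontr)
    assume "\<not> W \<subseteq> {0}"
    then obtain w where w: "w \<in> W" "w \<noteq> 0" by blast
    \<comment> \<open>As \<open>T\<close> spans the space, nondegeneracy is already visible on
      \<open>T\<close>; applying \<open>pr\<close> then moves the witness into
      \<open>W\<close>.\<close>
    have "\<exists>t\<in>T. f w t \<noteq> 0"
    proof (rule ccontr)
      assume "\<not> (\<exists>t\<in>T. f w t \<noteq> 0)"
      then have "T \<subseteq> {y. f w y = 0}" by blast
      moreover have "subspace {y. f w y = 0}"
        by (auto simp: subspace_def f_add_right f_scale_right)
      ultimately have "span T \<subseteq> {y. f w y = 0}" by (rule span_minimal)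
      then show False using spanning w(2) nondeg[of w] by auto
    qed
    then obtain t where "t \<in> T" "f w t \<noteq> 0" by blast
    then have "\<exists>p. p \<in> W \<times> W \<and> f (fst p) (snd p) \<noteq> 0"
      using prW[of t] W_pr[OF w(1), of t] w(1) by (intro exI[of _ "(w, pr t)"]) simp
    \<comment> \<open>Shifting by the lower bound \<open>N\<close> turns the valuations into natural
      numbers, among which a least one exists.\<close>
    then obtain p where p: "p \<in> W \<times> W \<and> f (fst p) (snd p) \<noteq> 0"
      and pmin: "\<forall>q. q \<in> W \<times> W \<and> f (fst q) (snd q) \<noteq> 0 \<longrightarrow>
          nat (val (f (fst p) (snd p)) - N) \<le> nat (val (f (fst q) (snd q)) - N)"
      using ex_has_least_nat[of "\<lambda>p. p \<in> W \<times> W \<and> f (fst p) (snd p) \<noteq> 0" _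
          "\<lambda>p. nat (val (f (fst p) (snd p)) - N)"]
      by blast
    obtain x y where xy: "p = (x, y)" by (cases p)
    have min: "f u v \<in> val_ge (val (f x y))" if "u \<in> W" "v \<in> W" for u v
    proof (cases "f u v = 0")
      case False
      have "N \<le> val (f u v)" "N \<le> val (f x y)"
        using bounded[of u v] bounded[of x y] that False p xy by (auto simp: W_def val_ge_def)
      then show ?thesis
        using pmin[rule_format, of "(u, v)"] that False by (simp add: xy val_ge_def)
    qed simp
    obtain z where z: "z \<in> W" "f z z \<noteq> 0" "val (f z z) = val (f x y)"
    proof (rule exists_anisotropic_minimal[of W x y])
      show "u + v \<in> W" if "u \<in> W" "v \<in> W" for u v
        using that T(2) by (simp add: W_def f_add_left)
      show "sc c u \<in> W" if "c \<in> val_ge 0" "u \<in> W" for c u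
        using that T(3) by (simp add: W_def f_scale_left)
    qed (use p xy min in auto)
    \<comment> \<open>Pairing with \<open>z\<close> sees only the component \<open>pr t\<close> in
      \<open>W\<close>, where the valuation of \<open>f z z\<close> is minimal.\<close>
    have "f t z / f z z \<in> val_ge 0" if "t \<in> T" for t
    proof -
      have "f z (pr t) \<in> val_ge (val (f z z))" using min[OF z(1) prW[OF that]] z(3) by simp
      then have "f t z \<in> val_ge (val (f z z))"
        using W_pr[OF z(1), of t] f_swap_val_ge by simp
      then show ?thesis using z(2) by (rule val_ge_divide) simp
    qed
    moreover have "f z x = 0" "f x z = 0" if "x \<in> X" for x
      using z(1) that f_swap_eq_0[of x z] by (simp_all add: W_def)
    ultimately have "good (insert z X)"
      using X z by (auto simp: good_def W_def)
    moreover have "z \<notin> X" using z by (auto simp: W_def)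
    ultimately show False using max[of "insert z X"] X by (simp add: good_def)
  qed
  have "T \<subseteq> span X"
  proof
    fix t assume "t \<in> T"
    then have "pr t = 0" using prW W_zero by blast
    then have "t = (\<Sum>x\<in>X. sc (f t x / f x x) x)" by (simp add: pr_def)
    also have "\<dots> \<in> span X" by (intro span_sum span_scale span_base)
    finally show "t \<in> span X" .
  qed
  then have "span X = UNIV" using spanning span_minimal[OF _ subspace_span] by blast
  then have "card X = dimension"
    using basis_card_eq_dim[of X UNIV] indep[OF X] by (simp add: dimension_def)
  then show ?thesis using that[of X] X by (auto simp: good_def)
qed

lemma lattice_hull_bounded:
  assumes "\<And>s t. s \<in> S \<Longrightarrow> t \<in> S \<Longrightarrow> f s t \<in> val_ge N"
    and "x \<in> lattice_hull sc S" "y \<in> lattice_hull sc S"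
  shows "f x y \<in> val_ge N"
  using assms(2)
proof (induction rule: lattice_hull.induct)
  case (add_gen a s x)
  have "f s y \<in> val_ge N"
    using assms(3)
  proof (induction rule: lattice_hull.induct)
    case (add_gen b t y)
    then show ?case
      using assms(1)[OF \<open>s \<in> S\<close> \<open>t \<in> S\<close>]
      by (auto simp: f_add_right f_scale_right conj_val_ge_iff
          intro!: val_ge_add val_ge_mult_le[of _ 0 _ N])
  qed simp
  then show ?case
    using add_gen by (auto simp: f_add_left f_scale_left intro!: val_ge_add val_ge_mult_le[of _ 0 _ N])
qed simp

text \<open>In an orthogonal basis of an invariant lattice, the matrix coefficients satisfy
  \<open>val (m i j) \<ge> max 0 (a j - a i)\<close> with \<open>a i = val (f (x i) (x i))\<close>. Dividing \<open>x i\<close> by the power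
  of the uniformizer of exponent \<open>a i div 2\<close> keeps this property and brings all \<open>a i\<close> into
  \<open>{0, 1}\<close>.\<close>

lemma reduced_basis:
  assumes \<Gamma>: "finite \<Gamma>" "id \<in> \<Gamma>" "\<And>g h. g \<in> \<Gamma> \<Longrightarrow> h \<in> \<Gamma> \<Longrightarrow> g \<circ> h \<in> \<Gamma>"
      "\<And>g. g \<in> \<Gamma> \<Longrightarrow> \<exists>h\<in>\<Gamma>. \<forall>x. g (h x) = x"
    and lin: "\<And>g. g \<in> \<Gamma> \<Longrightarrow> Vector_Spaces.linear sc sc g"
    and iso: "\<And>g x y. g \<in> \<Gamma> \<Longrightarrow> f (g x) (g y) = f x y"
  obtains y :: "nat \<Rightarrow> 'v" where
    "\<And>i j. i < dimension \<Longrightarrow> j < dimension \<Longrightarrow> i \<noteq> j \<Longrightarrow> f (y i) (y j) = 0"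
    "\<And>i. i < dimension \<Longrightarrow> f (y i) (y i) \<noteq> 0"
    "\<And>i. i < dimension \<Longrightarrow> val (f (y i) (y i)) \<in> {0, 1}"
    "\<And>g i j. g \<in> \<Gamma> \<Longrightarrow> i < dimension \<Longrightarrow> j < dimension \<Longrightarrow>
       f (g (y j)) (y i) / f (y i) (y i) \<in>
         val_ge (max 0 (val (f (y j) (y j)) - val (f (y i) (y i))))"
proof -
  \<comment> \<open>The translates of a basis are finite in number, so their hull is a bounded
    lattice stable under \<open>\<Gamma>\<close>.\<close>
  define S where "S = (\<Union>g\<in>\<Gamma>. g ` B)"
  define T where "T = lattice_hull sc S"
  have finS: "finite S" using \<Gamma>(1) finite_Basis by (simp add: S_def)
  have "b \<in> S" if "b \<in> B" for b
    unfolding S_def using \<Gamma>(2) imageI[OF that, of id] by (intro UN_I[of id]) simp_all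
  then have "B \<subseteq> S" by blast
  then have "B \<subseteq> T" using lattice_hull_base[OF vector_space_axioms] by (auto simp: T_def)
  then have spanT: "span T = UNIV" using span_mono[of B T] span_Basis by auto
  \<comment> \<open>Inserting 0 keeps the set nonempty in dimension 0; the unspecified
    \<open>val 0\<close> of vanishing pairings can only lower the minimum.\<close>
  define N where "N = Min (insert 0 ((\<lambda>(s, t). val (f s t)) ` (S \<times> S)))"
  have N: "N \<le> val (f s t)" if "s \<in> S" "t \<in> S" for s t
    unfolding N_def using that finS by (intro Min_le) auto
  have stable: "g x \<in> T" if g: "g \<in> \<Gamma>" and "x \<in> T" for g x
    using that(2) unfolding T_def
  proof (induction rule: lattice_hull.induct)
    case zero
    interpret g: Vector_Spaces.linear sc sc g using g by (rule lin)
    show ?case by (simp add: lattice_hull.zero)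
  next
    case (add_gen a s x)
    interpret g: Vector_Spaces.linear sc sc g using g by (rule lin)
    obtain h b where "h \<in> \<Gamma>" "b \<in> B" "s = h b" using add_gen by (auto simp: S_def)
    then have "g s \<in> S" using \<Gamma>(3)[OF g] unfolding S_def by (metis UN_I comp_apply image_eqI)
    then show ?case using add_gen by (simp add: g.add g.scale lattice_hull.add_gen)
  qed
  obtain X where X: "X \<subseteq> T" "finite X" "card X = dimension"
    and orth: "\<And>x y. x \<in> X \<Longrightarrow> y \<in> X \<Longrightarrow> x \<noteq> y \<Longrightarrow> f x y = 0" and ne: "\<And>x. x \<in> X \<Longrightarrow> f x x \<noteq> 0"
    and int: "\<And>x t. x \<in> X \<Longrightarrow> t \<in> T \<Longrightarrow> f t x / f x x \<in> val_ge 0"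
  proof (rule lattice_orthogonal_basis[of T N])
    show "f x y \<in> val_ge N" if "x \<in> T" "y \<in> T" for x y
      using that N unfolding T_def by (rule_tac lattice_hull_bounded[of S]) (auto simp: val_ge_def)
  qed (use spanT in \<open>auto simp: T_def lattice_hull.zero lattice_hull_add lattice_hull_scale[OF vector_space_axioms]\<close>)
  obtain x where x: "bij_betw x {0..<dimension} X"
    using ex_bij_betw_nat_finite[OF X(2)] X(3) by auto
  obtain \<pi> :: 'k where \<pi>: "\<pi> \<noteq> 0" "val \<pi> = 1" "\<sigma> \<pi> = \<pi>" by (rule uniformizer)
  define a where "a i = val (f (x i) (x i))" for i
  define q where "q i = \<pi> powi (- (a i div 2))" for i
  have q: "q i \<noteq> 0" "val (q i) = - (a i div 2)" "\<sigma> (q i) = q i" for i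
    using \<pi> by (simp_all add: q_def val_power_int)
      (simp add: power_int_def conj.hom_power conj.hom_inverse)
  define y where "y i = sc (q i) (x i)" for i
  have xX: "x i \<in> X" if "i < dimension" for i
    using bij_betwE[OF x] that by simp
  have fxx: "f (x i) (x i) \<noteq> 0" if "i < dimension" for i using ne xX that by blast
  have fy: "f (y i) (y j) = q i * q j * f (x i) (x j)" for i j
    by (simp add: y_def f_scale_left f_scale_right q)
  have c: "val (f (y i) (y i)) = a i mod 2" if "i < dimension" for i
    using fxx[OF that] q by (simp add: fy val_mult minus_mult_div_eq_mod[symmetric] a_def)
  have left: "f t (x i) \<in> val_ge (a i)" if "t \<in> T" "i < dimension" for t i
    using val_ge_mult[OF int[OF xX[OF that(2)] that(1)] val_ge_self[of "f (x i) (x i)"]] fxx[OF that(2)]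
    by (simp add: a_def)
  show ?thesis
  proof (rule that[of y])
    show "f (y i) (y j) = 0" if "i < dimension" "j < dimension" "i \<noteq> j" for i j
    proof -
      have "x i \<noteq> x j" using that x by (auto simp: bij_betw_def inj_on_def)
      then show ?thesis using orth xX that by (simp add: fy)
    qed
    show "f (y i) (y i) \<noteq> 0" if "i < dimension" for i
      using fxx[OF that] q by (simp add: fy)
    show "val (f (y i) (y i)) \<in> {0, 1}" if "i < dimension" for i
      using c[OF that] by auto
    fix g i j assume g: "g \<in> \<Gamma>" and i: "i < dimension" and j: "j < dimension"
    interpret g: Vector_Spaces.linear sc sc g using g by (rule lin)
    obtain h where h: "h \<in> \<Gamma>" "\<And>x. g (h x) = x" using \<Gamma>(4)[OF g] by blast
    have xT: "x i \<in> T" "x j \<in> T" using xX i j X(1) by blast+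
    \<comment> \<open>Moving \<open>g\<close> across the form as its inverse bounds the same pairing
      by \<open>a j\<close> as well as by \<open>a i\<close>.\<close>
    have "f (x j) (h (x i)) = f (g (x j)) (x i)" using iso[OF g, of "x j" "h (x i)"] h(2) by simp
    moreover have "f (x j) (h (x i)) \<in> val_ge (a j)"
      using left[OF stable[OF h(1) xT(1)] j] f_swap_val_ge by blast
    ultimately have "f (g (x j)) (x i) \<in> val_ge (max (a i) (a j))"
      using left[OF stable[OF g xT(2)] i] by (simp add: max_def)
    then have "q j * q i * f (g (x j)) (x i) \<in> val_ge (- (a j div 2) - a i div 2 + max (a i) (a j))"
      using q val_ge_mult[OF val_ge_self[of "q j"] val_ge_self[of "q i"]]
      by (intro val_ge_mult) simp_all
    moreover have "f (g (y j)) (y i) = q j * q i * f (g (x j)) (x i)"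
      by (simp add: y_def g.scale f_scale_left f_scale_right q)
    ultimately have "f (g (y j)) (y i) \<in> val_ge (- (a j div 2) - a i div 2 + max (a i) (a j))"
      by simp
    moreover have "f (y i) (y i) \<noteq> 0" using q fxx[OF i] by (simp add: fy)
    \<comment> \<open>Only nonnegativity is at stake unless \<open>a j\<close> is odd and
      \<open>a i\<close> even; then the two differ, and rounding in the halved exponents leaves the
      required extra 1.\<close>
    moreover have "max 0 (a j mod 2 - a i mod 2) \<le> - (a j div 2) - a i div 2 + max (a i) (a j) - a i mod 2"
      by presburger
    ultimately show "f (g (y j)) (y i) / f (y i) (y i) \<in>
         val_ge (max 0 (val (f (y j) (y j)) - val (f (y i) (y i))))"
      unfolding c[OF i, symmetric] c[OF j, symmetric] by (rule val_ge_divide)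
  qed
qed

end

section \<open>The reduced representation\<close>

text \<open>The lattice spanned by \<open>y\<close> is the orthogonal sum of a unimodular part
  (valuation 0) and a part that becomes unimodular once the form is divided by \<open>\<pi>\<close>
  (valuation 1).\<close>

locale reduced_hermitian_space = hermitian_space \<iota> \<sigma> sc B f \<epsilon>
  for \<iota> :: "'l::discrete_valuation_field \<Rightarrow> 'k::discrete_valuation_field" and \<sigma>
    and sc :: "'k \<Rightarrow> 'v::ab_group_add \<Rightarrow> 'v" and B f \<epsilon> +
  fixes y :: "nat \<Rightarrow> 'v" and \<pi> :: 'k
  assumes orth: "i < dimension \<Longrightarrow> j < dimension \<Longrightarrow> i \<noteq> j \<Longrightarrow> f (y i) (y j) = 0"
    and anisotropic: "i < dimension \<Longrightarrow> f (y i) (y i) \<noteq> 0"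
    and val_01: "i < dimension \<Longrightarrow> val (f (y i) (y i)) \<in> {0, 1}"
    and \<pi>: "\<pi> \<noteq> 0" "val \<pi> = 1" "\<sigma> \<pi> = \<pi>"
begin

section \<open>Coordinates in the orthogonal basis\<close>

definition d :: "nat \<Rightarrow> 'k" where "d i = f (y i) (y i)"

definition c :: "nat \<Rightarrow> int" where "c i = val (d i)"

text \<open>By orthogonality these are the coordinates in the basis \<open>y\<close>; expressed
  through the form, they are linear and computable without choosing a representation.\<close>

definition coord :: "nat \<Rightarrow> 'v \<Rightarrow> 'k" where "coord i v = f v (y i) / d i"

lemma d_nonzero: "i < dimension \<Longrightarrow> d i \<noteq> 0"
  by (simp add: d_def anisotropic)

lemma c_cases: "i < dimension \<Longrightarrow> c i = 0 \<or> c i = 1"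
  using val_01[of i] by (auto simp: c_def d_def)

lemma coord_add: "coord i (u + v) = coord i u + coord i v"
  and coord_diff: "coord i (u - v) = coord i u - coord i v"
  and coord_scale: "coord i (sc a v) = a * coord i v"
  by (simp_all add: coord_def f_add_left f_diff_left f_scale_left add_divide_distrib diff_divide_distrib)

lemma coord_0 [simp]: "coord i 0 = 0"
  by (simp add: coord_def)

lemma coord_sum: "coord i (sum g A) = (\<Sum>k\<in>A. coord i (g k))"
  by (induction A rule: infinite_finite_induct) (simp_all add: coord_add)

lemma coord_y: "i < dimension \<Longrightarrow> j < dimension \<Longrightarrow> coord i (y j) = (if i = j then 1 else 0)"
  using d_nonzero by (simp add: coord_def orth) (simp add: d_def)

lemma y_inj: "inj_on y {0..<dimension}"
  using orth anisotropic by (intro inj_onI) (metis atLeastLessThan_iff)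

lemma y_independent: "independent (y ` {0..<dimension})"
proof (rule orthogonal_independent)
  show "f u v = 0" if "u \<in> y ` {0..<dimension}" "v \<in> y ` {0..<dimension}" "u \<noteq> v" for u v
  proof -
    obtain i j where "i < dimension" "j < dimension" "u = y i" "v = y j" using \<open>u \<in> _\<close> \<open>v \<in> _\<close> by auto
    then show ?thesis using orth[of i j] \<open>u \<noteq> v\<close> by blast
  qed
qed (use anisotropic in auto)

lemma y_spanning: "span (y ` {0..<dimension}) = UNIV"
  using card_ge_dim_independent[OF subset_UNIV y_independent] card_image[OF y_inj]
  by (auto simp: dimension_def)

text \<open>The difference is orthogonal to every \<open>y k\<close>, and these span the space, so
  nondegeneracy makes it 0.\<close>

lemma expand: "v = (\<Sum>i = 0..<dimension. sc (coord i v) (y i))"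
proof -
  define w where "w = v - (\<Sum>i = 0..<dimension. sc (coord i v) (y i))"
  have "f w (y k) = 0" if "k < dimension" for k
  proof -
    have "coord k (\<Sum>i = 0..<dimension. sc (coord i v) (y i)) =
        (\<Sum>i = 0..<dimension. if i = k then coord k v else 0)"
      unfolding coord_sum using that by (intro sum.cong) (auto simp: coord_scale coord_y)
    then have "coord k w = 0" using that by (simp add: w_def coord_diff)
    then show ?thesis using d_nonzero[OF that] by (simp add: coord_def)
  qed
  then have "y ` {0..<dimension} \<subseteq> {z. f w z = 0}" by auto
  moreover have "subspace {z. f w z = 0}"
    by (auto simp: subspace_def f_add_right f_scale_right)
  ultimately have "span (y ` {0..<dimension}) \<subseteq> {z. f w z = 0}" by (rule span_minimal)
  then have "w = 0" using y_spanning nondeg[of w] by auto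
  then show ?thesis by (simp add: w_def)
qed

lemma representation_y:
  assumes "i < dimension"
  shows "representation (y ` {0..<dimension}) v (y i) = coord i v"
proof -
  interpret r: Vector_Spaces.linear sc "(*)" "\<lambda>v. representation (y ` {0..<dimension}) v (y i)"
    by (rule linear_representation[OF y_independent y_spanning])
  have "representation (y ` {0..<dimension}) v (y i) =
      representation (y ` {0..<dimension}) (\<Sum>k = 0..<dimension. sc (coord k v) (y k)) (y i)"
    by (rule arg_cong[OF expand])
  also have "\<dots> = (\<Sum>k = 0..<dimension. coord k v * representation (y ` {0..<dimension}) (y k) (y i))"
    by (simp add: r.sum r.scale)
  also have "\<dots> = (\<Sum>k = 0..<dimension. if k = i then coord i v else 0)"
    using assms inj_onD[OF y_inj]
    by (intro sum.cong) (auto simp: representation_basis[OF y_independent])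
  finally show ?thesis using assms by simp
qed

lemma f_coord: "f u v = (\<Sum>i = 0..<dimension. d i * coord i u * \<sigma> (coord i v))"
proof -
  have "f u v = f u (\<Sum>i = 0..<dimension. sc (coord i v) (y i))"
    by (rule arg_cong[OF expand])
  also have "\<dots> = (\<Sum>i = 0..<dimension. \<sigma> (coord i v) * f u (y i))"
    by (simp add: f_sum_right f_scale_right)
  also have "\<dots> = (\<Sum>i = 0..<dimension. d i * coord i u * \<sigma> (coord i v))"
    using d_nonzero by (intro sum.cong) (auto simp: coord_def)
  finally show ?thesis .
qed

text \<open>The bound says that the matrix is integral and that its entries from the part
  \<open>c = 1\<close> to the part \<open>c = 0\<close> are divisible by \<open>\<pi>\<close>:
  \<open>g\<close> maps both \<open>T\<close> and \<open>\<pi> T*\<close> into themselves.\<close>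

definition admissible :: "('v \<Rightarrow> 'v) \<Rightarrow> bool" where
  "admissible g \<longleftrightarrow> Vector_Spaces.linear sc sc g \<and> (\<forall>u v. f (g u) (g v) = f u v) \<and>
     (\<forall>i<dimension. \<forall>j<dimension. coord i (g (y j)) \<in> val_ge (max 0 (c j - c i)))"

text \<open>The action on the sum of \<open>T / \<pi> T*\<close> (indices with \<open>c = 0\<close>)
  and \<open>\<pi> T* / \<pi> T\<close> (indices with \<open>c = 1\<close>); dropping the
  off-diagonal blocks is the passage to the graded space.\<close>

definition red :: "('v \<Rightarrow> 'v) \<Rightarrow> 'k residue_field mat" where
  "red g = mat dimension dimension
     (\<lambda>(i, j). if c i = c j then residue (coord i (g (y j))) else 0)"

lemma red_carrier [simp]: "red g \<in> carrier_mat dimension dimension"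
  and dim_row_red [simp]: "dim_row (red g) = dimension"
  and dim_col_red [simp]: "dim_col (red g) = dimension"
  by (simp_all add: red_def)

lemma red_index:
  "i < dimension \<Longrightarrow> j < dimension \<Longrightarrow>
     red g $$ (i, j) = (if c i = c j then residue (coord i (g (y j))) else 0)"
  by (simp add: red_def)

lemma admissible_linear: "admissible g \<Longrightarrow> Vector_Spaces.linear sc sc g"
  by (simp add: admissible_def)

lemma admissible_coord:
  "admissible g \<Longrightarrow> i < dimension \<Longrightarrow> j < dimension \<Longrightarrow>
     coord i (g (y j)) \<in> val_ge (max 0 (c j - c i))"
  by (simp add: admissible_def)

lemma admissible_integral:
  "admissible g \<Longrightarrow> i < dimension \<Longrightarrow> j < dimension \<Longrightarrow> coord i (g (y j)) \<in> val_ge 0"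
  using admissible_coord[of g i j] by (rule val_ge_mono) auto

lemma coord_linear:
  assumes "Vector_Spaces.linear sc sc g"
  shows "coord i (g v) = (\<Sum>k = 0..<dimension. coord i (g (y k)) * coord k v)"
proof -
  interpret g: Vector_Spaces.linear sc sc g by (rule assms)
  have "coord i (g v) = coord i (g (\<Sum>k = 0..<dimension. sc (coord k v) (y k)))"
    by (rule arg_cong[OF expand])
  then show ?thesis by (simp add: g.sum g.scale coord_sum coord_scale mult.commute)
qed

lemma admissible_id: "admissible id"
  by (auto simp: admissible_def linear_id coord_y)

lemma red_id: "red id = 1\<^sub>m dimension"
  by (rule eq_matI) (auto simp: red_def coord_y residue_0 residue_1)

lemma admissible_comp:
  assumes g: "admissible g" and h: "admissible h"
  shows "admissible (g \<circ> h)"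
  unfolding admissible_def
proof (intro conjI allI impI)
  show "Vector_Spaces.linear sc sc (g \<circ> h)"
    using admissible_linear[OF h] admissible_linear[OF g] by (rule Vector_Spaces.linear_compose)
  show "f ((g \<circ> h) u) ((g \<circ> h) v) = f u v" for u v
    using g h by (simp add: admissible_def)
  show "coord i ((g \<circ> h) (y j)) \<in> val_ge (max 0 (c j - c i))"
    if i: "i < dimension" and j: "j < dimension" for i j
    unfolding o_apply coord_linear[OF admissible_linear[OF g], of i "h (y j)"]
  proof (rule val_ge_sum)
    fix k assume "k \<in> {0..<dimension}"
    then show "coord i (g (y k)) * coord k (h (y j)) \<in> val_ge (max 0 (c j - c i))"
      using i j by (intro val_ge_mult_le[OF admissible_coord[OF g] admissible_coord[OF h]]) auto
  qed
qed

lemma admissible_funpow: "admissible g \<Longrightarrow> admissible (g ^^ m)"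
  by (induction m) (auto intro: admissible_id admissible_comp simp flip: id_def)

lemma red_comp:
  assumes g: "admissible g" and h: "admissible h"
  shows "red (g \<circ> h) = red g * red h"
proof (rule eq_matI)
  fix i j assume "i < dim_row (red g * red h)" "j < dim_col (red g * red h)"
  then have i: "i < dimension" and j: "j < dimension" by simp_all
  have "(red g * red h) $$ (i, j) = (\<Sum>k = 0..<dimension. red g $$ (i, k) * red h $$ (k, j))"
    using i j by (simp add: scalar_prod_def)
  also have "\<dots> = (\<Sum>k = 0..<dimension.
      if c i = c j then residue (coord i (g (y k)) * coord k (h (y j))) else 0)"
  proof (rule sum.cong)
    fix k assume "k \<in> {0..<dimension}"
    then have k: "k < dimension" by simp
    show "red g $$ (i, k) * red h $$ (k, j) =
        (if c i = c j then residue (coord i (g (y k)) * coord k (h (y j))) else 0)"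
    proof (cases "c i = c k")
      case True
      then show ?thesis
        using i j k admissible_integral[OF g i k] admissible_integral[OF h k j]
        by (simp add: red_index residue_mult_val_ge)
    next
      case False
      \<comment> \<open>A path from one part to the other and back passes once from
        \<open>c = 1\<close> to \<open>c = 0\<close> and picks up a factor \<open>\<pi>\<close>
        there.\<close>
      have "coord i (g (y k)) * coord k (h (y j)) \<in> val_ge 1" if "c i = c j"
        using False that c_cases[OF i] c_cases[OF k]
        by (intro val_ge_mult_le[OF admissible_coord[OF g i k] admissible_coord[OF h k j]]) auto
      then show ?thesis using False i j k by (auto simp: red_index residue_eq_0)
    qed
  qed simp
  also have "\<dots> = red (g \<circ> h) $$ (i, j)"
  proof -
    have "residue (\<Sum>k = 0..<dimension. coord i (g (y k)) * coord k (h (y j))) =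
        (\<Sum>k = 0..<dimension. residue (coord i (g (y k)) * coord k (h (y j))))"
      using i j by (intro residue_sum val_ge_mult_le[OF admissible_integral[OF g] admissible_integral[OF h]]) auto
    then show ?thesis
      using i j by (simp add: red_index coord_linear[OF admissible_linear[OF g], of i "h (y j)"])
  qed
  finally show "red (g \<circ> h) $$ (i, j) = (red g * red h) $$ (i, j)" by simp
qed simp_all

lemma red_funpow: "admissible g \<Longrightarrow> red g = 1\<^sub>m dimension \<Longrightarrow> red (g ^^ m) = 1\<^sub>m dimension"
  by (induction m) (auto simp: red_id red_comp admissible_funpow simp flip: id_def)

lemma reduces_to_red:
  assumes g: "admissible g"
  shows "reduces_to (endo_char_poly sc g) (char_poly (red g))"
proof -
  let ?ys = "map y [0..<dimension]"
  let ?M = "mat dimension dimension (\<lambda>(i, j). coord i (g (y j)))"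
  have set: "set ?ys = y ` {0..<dimension}" by simp
  have "ordered_basis sc ?ys"
    by (rule ordered_basisI) (simp_all add: distinct_map y_inj y_independent y_spanning)
  then have "endo_char_poly sc g = char_poly (matrix_of sc ?ys g)"
    using admissible_linear[OF g] by (rule endo_char_poly_eq)
  also have "matrix_of sc ?ys g = ?M"
    unfolding matrix_of_def set by (rule eq_matI) (auto simp: representation_y)
  finally have eq: "endo_char_poly sc g = char_poly ?M" .
  \<comment> \<open>As \<open>c\<close> takes only two values, equality of values becomes membership
    in a single index set, as the block lemma wants it.\<close>
  have "c i = c j \<longleftrightarrow> (c i = 0 \<longleftrightarrow> c j = 0)" if "i < dimension" "j < dimension" for i j
    using c_cases[OF that(1)] c_cases[OF that(2)] by auto
  then have "red g = mat dimension dimension (\<lambda>(i, j).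
      if i \<in> {i. c i = 0} \<longleftrightarrow> j \<in> {i. c i = 0} then residue (?M $$ (i, j)) else 0)"
    unfolding red_def by (intro cong_mat) simp_all
  moreover have "?M $$ (i, j) \<in> val_ge 1"
    if "i < dimension" "j < dimension" "i \<in> {i. c i = 0}" "j \<notin> {i. c i = 0}" for i j
    using admissible_coord[OF g that(1,2)] that c_cases[of j] by auto
  ultimately show ?thesis
    unfolding eq using admissible_integral[OF g]
    by (simp only:) (rule reduces_to_char_poly_blocks; simp)
qed

section \<open>The reduced form and its invariance\<close>

definition D :: "nat \<Rightarrow> 'k residue_field" where
  "D i = residue (d i / \<pi> powi c i)"

text \<open>The orthogonal sum of the reductions of \<open>f\<close> on \<open>T / \<pi> T*\<close>
  and of \<open>f / \<pi>\<close> on \<open>\<pi> T* / \<pi> T\<close>, in diagonal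
  coordinates.\<close>

definition form :: "'k residue_field vec \<Rightarrow> 'k residue_field vec \<Rightarrow> 'k residue_field" where
  "form u v = (\<Sum>i = 0..<dimension. D i * u $ i * residue_conj (v $ i))"

sublocale residue_conj: field_hom residue_conj
  using conjugation_residue_conj by (simp add: conjugation_def)

lemma residue_conj_involution [simp]: "residue_conj (residue_conj a) = a"
proof -
  obtain x where "x \<in> val_ge 0" "residue x = a" by (rule residue_cases)
  then show ?thesis
    using residue_conj_residue[of x] residue_conj_residue[of "\<sigma> x"] by (simp add: conj_val_ge_iff)
qed

lemma val_pi_power: "\<pi> powi k \<noteq> 0" "val (\<pi> powi k) = k"
  using \<pi> by (simp_all add: val_power_int)

lemma conj_pi_power: "\<sigma> (\<pi> powi k) = \<pi> powi k"
  using \<pi> by (simp add: power_int_def conj.hom_power conj.hom_inverse)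

lemma d_scaled: "i < dimension \<Longrightarrow> d i / \<pi> powi k \<in> val_ge (c i - k)"
  by (simp add: val_ge_def val_divide[OF d_nonzero val_pi_power(1)] val_pi_power(2) c_def)

lemma D_nonzero: "i < dimension \<Longrightarrow> D i \<noteq> 0"
  using d_scaled[of i "c i"] d_nonzero[of i] val_pi_power(1)[of "c i"]
  by (simp add: D_def residue_eq_0_iff)
    (simp add: val_ge_def val_divide[OF d_nonzero val_pi_power(1)] val_pi_power(2) c_def)

lemma sign_integral: "\<epsilon> \<in> val_ge 0"
  using sign by (auto simp: val_ge_uminus)

text \<open>Since \<open>\<sigma>\<close> fixes \<open>\<pi>\<close>, dividing by its powers
  preserves the symmetry with sign \<open>\<epsilon>\<close>.\<close>

lemma D_conj: "i < dimension \<Longrightarrow> D i = residue \<epsilon> * residue_conj (D i)"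
proof -
  assume i: "i < dimension"
  have "d i / \<pi> powi c i = \<epsilon> * \<sigma> (d i / \<pi> powi c i)"
    using herm[of "y i" "y i"] by (simp add: conj.hom_div conj_pi_power d_def)
  then have "residue (d i / \<pi> powi c i) = residue (\<epsilon> * \<sigma> (d i / \<pi> powi c i))" by (rule arg_cong)
  also have "\<dots> = residue \<epsilon> * residue (\<sigma> (d i / \<pi> powi c i))"
    using d_scaled[OF i, of "c i"] sign_integral by (simp add: residue_mult_val_ge conj_val_ge_iff)
  also have "residue (\<sigma> (d i / \<pi> powi c i)) = residue_conj (residue (d i / \<pi> powi c i))"
    using d_scaled[OF i, of "c i"] by (simp add: residue_conj_residue)
  finally show ?thesis unfolding D_def .
qed

lemma form_swap: "form v u = residue \<epsilon> * residue_conj (form u v)"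
proof -
  have "residue \<epsilon> * residue_conj (form u v) =
      (\<Sum>i = 0..<dimension. (residue \<epsilon> * residue_conj (D i)) * v $ i * residue_conj (u $ i))"
    by (simp add: form_def residue_conj.hom_sum residue_conj.hom_mult sum_distrib_left mult_ac)
  also have "\<dots> = form v u"
    unfolding form_def by (intro sum.cong) (auto simp flip: D_conj)
  finally show ?thesis ..
qed

lemma form_sesquilinear: "sesquilinear (carrier_vec dimension) (\<cdot>\<^sub>v) residue_conj form"
  by (auto simp: sesquilinear_def form_def residue_conj.hom_add residue_conj.hom_mult
      algebra_simps sum.distrib sum_distrib_left)

lemma form_nondegenerate: "nondegenerate (carrier_vec dimension) (0\<^sub>v dimension) form"
proof -
  have zero: "x = 0\<^sub>v dimension"
    if x: "x \<in> carrier_vec dimension" and f0: "\<forall>z\<in>carrier_vec dimension. form x z = 0" for x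
  proof (rule eq_vecI)
    fix i assume "i < dim_vec (0\<^sub>v dimension :: 'k residue_field vec)"
    then have i: "i < dimension" by simp
    have "0 = form x (unit_vec dimension i)" using f0 by simp
    also have "\<dots> = (\<Sum>k = 0..<dimension. if k = i then D i * x $ i else 0)"
      unfolding form_def using i by (intro sum.cong) auto
    finally show "x $ i = 0\<^sub>v dimension $ i" using i D_nonzero[OF i] by simp
  qed (use x in simp)
  moreover have "form x z = 0" if "form z x = 0" for x z
    using that form_swap[of x z] by simp
  ultimately show ?thesis unfolding nondegenerate_def by blast
qed

text \<open>For \<open>j\<close> and \<open>k\<close> in different parts every summand has a zero
  factor. Within one part the identity is the reduction of
  \<open>f (g (y j)) (g (y k)) = f (y j) (y k)\<close> divided by \<open>\<pi> powi s\<close>, where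
  the terms from the other part disappear.\<close>

lemma red_columns:
  assumes g: "admissible g" and j: "j < dimension" and k: "k < dimension"
  shows "(\<Sum>i = 0..<dimension. D i * red g $$ (i, j) * residue_conj (red g $$ (i, k))) =
    (if j = k then D j else 0)"
proof (cases "c j = c k")
  case False
  have "D i * red g $$ (i, j) * residue_conj (red g $$ (i, k)) = 0" if "i < dimension" for i
    using that j k False by (auto simp: red_index)
  then have "(\<Sum>i = 0..<dimension. D i * red g $$ (i, j) * residue_conj (red g $$ (i, k))) = 0"
    by (intro sum.neutral) auto
  then show ?thesis using False by auto
next
  case True
  define s where "s = c j"
  define m where "m i j = coord i (g (y j))" for i j
  define t where "t i = d i / \<pi> powi s * m i j * \<sigma> (m i k)" for i
  have ck: "c k = s" using True by (simp add: s_def)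
  have m: "m i j \<in> val_ge (max 0 (s - c i))" "\<sigma> (m i k) \<in> val_ge (max 0 (s - c i))"
    if "i < dimension" for i
    using admissible_coord[OF g that j] admissible_coord[OF g that k]
    by (simp_all add: m_def s_def True conj_val_ge_iff)
  have t: "t i \<in> val_ge (c i - s + max 0 (s - c i) + max 0 (s - c i))" if "i < dimension" for i
    unfolding t_def using m d_scaled that by (intro val_ge_mult)
  have t0: "t i \<in> val_ge 0" if "i < dimension" for i
    using t[OF that] by (rule val_ge_mono) (auto simp: max_def)
  have "D i * red g $$ (i, j) * residue_conj (red g $$ (i, k)) = residue (t i)"
    if i: "i < dimension" for i
  proof (cases "c i = s")
    case True
    then have int: "m i j \<in> val_ge 0" "m i k \<in> val_ge 0" "d i / \<pi> powi s \<in> val_ge 0"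
      using m[OF i] d_scaled[OF i, of s] by (simp_all add: conj_val_ge_iff)
    then have "d i / \<pi> powi s * m i j \<in> val_ge 0" by (intro val_ge_mult_le) auto
    then show ?thesis
      using i j k True ck int
      by (simp add: red_index t_def D_def residue_mult_val_ge residue_conj_residue conj_val_ge_iff
          del: times_divide_eq_left times_divide_eq_right flip: m_def s_def)
  next
    case False
    \<comment> \<open>If \<open>c i\<close> exceeds \<open>s\<close>, the factor \<open>d i\<close>
      provides the extra \<open>\<pi>\<close>. If it is smaller, the division loses one
      \<open>\<pi>\<close> but each of the two coordinates contributes one.\<close>
    then have "1 \<le> c i - s + max 0 (s - c i) + max 0 (s - c i)"
      using c_cases[OF i] c_cases[OF j] by (auto simp: s_def)
    then have "residue (t i) = 0" by (rule residue_eq_0[OF val_ge_mono[OF t[OF i]]])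
    then show ?thesis using False i j by (simp add: red_index flip: s_def)
  qed
  then have "(\<Sum>i = 0..<dimension. D i * red g $$ (i, j) * residue_conj (red g $$ (i, k))) =
      (\<Sum>i = 0..<dimension. residue (t i))"
    by (intro sum.cong) auto
  also have "\<dots> = residue (\<Sum>i = 0..<dimension. t i)"
    using t0 by (intro residue_sum[symmetric]) auto
  also have "(\<Sum>i = 0..<dimension. t i) = f (g (y j)) (g (y k)) / \<pi> powi s"
    by (simp add: f_coord[of "g (y j)"] t_def m_def sum_divide_distrib)
  also have "f (g (y j)) (g (y k)) = f (y j) (y k)" using g by (simp add: admissible_def)
  also have "residue (f (y j) (y k) / \<pi> powi s) = (if j = k then D j else 0)"
    using j k by (simp add: orth residue_0) (simp add: D_def d_def s_def)
  finally show ?thesis .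
qed

lemma form_red:
  assumes g: "admissible g" and u: "u \<in> carrier_vec dimension" and v: "v \<in> carrier_vec dimension"
  shows "form (red g *\<^sub>v u) (red g *\<^sub>v v) = form u v"
proof -
  let ?I = "{0..<dimension}"
  let ?r = "\<lambda>i j. red g $$ (i, j)"
  have mv: "(red g *\<^sub>v w) $ i = (\<Sum>j\<in>?I. ?r i j * w $ j)"
    if "i < dimension" "w \<in> carrier_vec dimension" for i w
    using that by (simp add: scalar_prod_def)
  have "form (red g *\<^sub>v u) (red g *\<^sub>v v) =
      (\<Sum>i\<in>?I. D i * (\<Sum>j\<in>?I. ?r i j * u $ j) * (\<Sum>k\<in>?I. residue_conj (?r i k) * residue_conj (v $ k)))"
    unfolding form_def using u v
    by (intro sum.cong) (simp_all add: mv residue_conj.hom_sum residue_conj.hom_mult del: index_mult_mat_vec)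
  also have "\<dots> = (\<Sum>i\<in>?I. \<Sum>j\<in>?I. \<Sum>k\<in>?I.
      (D i * ?r i j * residue_conj (?r i k)) * (u $ j * residue_conj (v $ k)))"
    by (simp add: sum_distrib_left sum_distrib_right mult_ac)
  also have "\<dots> = (\<Sum>j\<in>?I. \<Sum>i\<in>?I. \<Sum>k\<in>?I.
      (D i * ?r i j * residue_conj (?r i k)) * (u $ j * residue_conj (v $ k)))"
    by (rule sum.swap)
  also have "\<dots> = (\<Sum>j\<in>?I. \<Sum>k\<in>?I. \<Sum>i\<in>?I.
      (D i * ?r i j * residue_conj (?r i k)) * (u $ j * residue_conj (v $ k)))"
    by (intro sum.cong refl sum.swap)
  also have "\<dots> = (\<Sum>j\<in>?I. \<Sum>k\<in>?I.
      (\<Sum>i\<in>?I. D i * ?r i j * residue_conj (?r i k)) * (u $ j * residue_conj (v $ k)))"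
    by (simp add: sum_distrib_right)
  also have "\<dots> = (\<Sum>j\<in>?I. \<Sum>k\<in>?I. if k = j then D j * u $ j * residue_conj (v $ j) else 0)"
    by (intro sum.cong refl) (auto simp: red_columns[OF g])
  also have "\<dots> = form u v" by (simp add: form_def)
  finally show ?thesis .
qed

section \<open>Faithfulness of the reduction on elements of finite order\<close>

definition lattice_filtration :: "int \<Rightarrow> 'v set" where
  "lattice_filtration k = {v. \<forall>i<dimension. coord i v \<in> val_ge k}"

sublocale filtration: filtered_space sc lattice_filtration
proof
  fix x :: 'v
  show "x = 0" if "\<And>k. x \<in> lattice_filtration k"
  proof -
    have "coord i x = 0" if i: "i < dimension" for i
    proof (rule val_ge_eq_0)
      show "coord i x \<in> val_ge k" for k
        using \<open>\<And>k. x \<in> lattice_filtration k\<close>[of k] i by (simp add: lattice_filtration_def)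
    qed
    then show ?thesis by (subst expand) simp
  qed
  define N where "N = Min (insert 0 ((\<lambda>i. val (coord i x)) ` {0..<dimension}))"
  have "N \<le> val (coord i x)" if "i < dimension" for i
    unfolding N_def using that by (intro Min_le) auto
  then show "\<exists>k. x \<in> lattice_filtration k"
    by (intro exI[of _ N]) (auto simp: lattice_filtration_def val_ge_def)
qed (auto simp: lattice_filtration_def coord_add coord_scale intro: val_ge_add val_ge_mult)

text \<open>Trivial reduction makes all entries of \<open>h = g - 1\<close> divisible by
  \<open>\<pi>\<close> except those from \<open>c = 0\<close> to \<open>c = 1\<close>. Two
  consecutive steps cannot both be of that kind, so the square of \<open>h\<close> is divisible by
  \<open>\<pi>\<close> and \<open>torsion_trivial\<close> applies.\<close>

lemma red_faithful_prime:
  assumes g: "admissible g" "red g = 1\<^sub>m dimension"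
    and p: "prime p" "(of_nat p :: 'k) \<noteq> 0"
      "val (of_nat p :: 'k) = 0 \<or> 2 * val (of_nat p :: 'k) < int p - 1"
    and tors: "g ^^ p = id"
  shows "g = id"
proof -
  interpret g: Vector_Spaces.linear sc sc g using g(1) by (rule admissible_linear)
  define h where "h v = g v - v" for v
  define m where "m i k = coord i (h (y k))" for i k
  have lin: "Vector_Spaces.linear sc sc h"
    by unfold_locales (simp_all add: h_def g.add g.scale scale_right_diff_distrib)
  have coord_h: "coord i (h v) = (\<Sum>k = 0..<dimension. m i k * coord k v)" for i v
    unfolding m_def by (rule coord_linear[OF lin])
  have m_eq: "m i k = coord i (g (y k)) - (if i = k then 1 else 0)"
    if "i < dimension" "k < dimension" for i k
    using that by (simp add: m_def h_def coord_diff coord_y)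
  have m0: "m i k \<in> val_ge 0" if "i < dimension" "k < dimension" for i k
    unfolding m_eq[OF that] using admissible_integral[OF g(1) that] by (auto intro: val_ge_diff)
  have m1: "m i k \<in> val_ge 1" if ik: "i < dimension" "k < dimension" and c: "c i \<le> c k" for i k
  proof (cases "c i = c k")
    case True
    have "residue (coord i (g (y k))) = (if i = k then 1 else 0)"
      using arg_cong[OF g(2), of "\<lambda>A. A $$ (i, k)"] ik True by (simp add: red_index)
    then have "residue (coord i (g (y k))) = residue (if i = k then 1 else 0)"
      by (simp add: residue_0 residue_1)
    then show ?thesis
      unfolding m_eq[OF ik] using admissible_integral[OF g(1) ik]
      by (subst residue_eq_iff_val_ge[symmetric]) auto
  next
    case False
    then have "i \<noteq> k" by auto
    then show ?thesis
      using False c admissible_coord[OF g(1) ik] by (auto simp: m_eq[OF ik] elim!: val_ge_mono)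
  qed
  have h_mem: "coord i (h v) \<in> val_ge k" if "v \<in> lattice_filtration k" "i < dimension" for v k i
    unfolding coord_h using that m0
    by (intro val_ge_sum val_ge_mult_le[of _ 0 _ k]) (auto simp: lattice_filtration_def)
  have h_mem1: "coord i (h v) \<in> val_ge (k + 1)"
    if "v \<in> lattice_filtration k" "i < dimension" "c i = 0" for v k i
    unfolding coord_h
  proof (rule val_ge_sum)
    fix j assume j: "j \<in> {0..<dimension}"
    then have "m i j \<in> val_ge 1" using m1[of i j] that c_cases[of j] by auto
    then show "m i j * coord j v \<in> val_ge (k + 1)"
      using that j by (intro val_ge_mult_le[of _ 1 _ k]) (auto simp: lattice_filtration_def)
  qed
  have h_sq: "coord i (h (h v)) \<in> val_ge (k + 1)"
    if v: "v \<in> lattice_filtration k" and i: "i < dimension" for v k i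
    unfolding coord_h[of i "h v"]
  proof (rule val_ge_sum)
    fix j assume "j \<in> {0..<dimension}"
    then have j: "j < dimension" by simp
    \<comment> \<open>Either the outer entry is divisible by \<open>\<pi>\<close>, or it starts at
      an index with \<open>c j = 0\<close>, where \<open>h v\<close> has already gained a
      factor.\<close>
    show "m i j * coord j (h v) \<in> val_ge (k + 1)"
    proof (cases "c i \<le> c j")
      case True
      then show ?thesis using m1[OF i j] h_mem[OF v j] by (intro val_ge_mult_le[of _ 1 _ k]) auto
    next
      case False
      then have "c j = 0" using c_cases[OF i] c_cases[OF j] by auto
      then show ?thesis using m0[OF i j] h_mem1[OF v j] by (intro val_ge_mult_le[of _ 0 _ "k + 1"]) auto
    qed
  qed
  have "h v = 0" for v
  proof (rule filtration.torsion_trivial[OF lin _ _ p])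
    show "((\<lambda>v. v + h v) ^^ p) v = v" for v using tors by (simp add: h_def)
  qed (use h_mem h_sq in \<open>auto simp: lattice_filtration_def\<close>)
  then show ?thesis by (auto simp: h_def)
qed

text \<open>Prime factors are peeled off the exponent: if \<open>N = p * m\<close>, then
  \<open>g ^^ m\<close> has trivial reduction and is killed by \<open>p\<close>, hence is the
  identity, and the smaller exponent \<open>m\<close> works.\<close>

lemma red_faithful:
  assumes p: "\<And>p. prime p \<Longrightarrow> (of_nat p :: 'k) \<noteq> 0 \<and>
      (val (of_nat p :: 'k) = 0 \<or> 2 * val (of_nat p :: 'k) < int p - 1)"
    and g: "admissible g" "red g = 1\<^sub>m dimension"
    and tors: "g ^^ N = id" "0 < N"
  shows "g = id"
  using tors
proof (induction N rule: less_induct)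
  case (less N)
  show ?case
  proof (cases "N = 1")
    case False
    then obtain p where p': "prime p" "p dvd N" using prime_factor_nat by blast
    then obtain m where m: "N = p * m" by blast
    have "(g ^^ m) ^^ p = id" using less.prems(1) unfolding funpow_mult m by (simp only: mult.commute)
    then have "g ^^ m = id"
      using admissible_funpow[OF g(1)] red_funpow[OF g] p[OF p'(1)]
      by (rule_tac red_faithful_prime[OF _ _ p'(1)]) simp_all
    moreover have "0 < m" "m < N" using less.prems(2) prime_gt_1_nat[OF p'(1)] by (auto simp: m)
    ultimately show ?thesis using less.IH by blast
  qed (use less.prems in simp)
qed

end

section \<open>Reduction of finite unitary groups\<close>

text \<open>The conjugation and the sign of the reduced form are made explicit, so that both cases
  of the theorem can be read off.\<close>

lemma (in hermitian_space) reduction_exists: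
  fixes G :: "('g, 'm) monoid_scheme" and \<rho> :: "'g \<Rightarrow> 'v \<Rightarrow> 'v"
  assumes primes: "\<And>p. prime p \<Longrightarrow> (of_nat p :: 'k) \<noteq> 0 \<and>
      (val (of_nat p :: 'k) = 0 \<or> 2 * val (of_nat p :: 'k) < int p - 1)"
    and G: "group G" "finite (carrier G)"
    and \<rho>: "\<rho> \<in> hom G (Aut_pairing sc f)" "inj_on \<rho> (carrier G)"
  shows "\<exists>f\<^sub>0 (\<rho>' :: 'g \<Rightarrow> 'k residue_field mat).
    nondegenerate (carrier_vec dimension) (0\<^sub>v dimension) f\<^sub>0 \<and>
    sesquilinear (carrier_vec dimension) (\<cdot>\<^sub>v) residue_conj f\<^sub>0 \<and>
    (\<forall>x y. f\<^sub>0 y x = residue \<epsilon> * residue_conj (f\<^sub>0 x y)) \<and>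
    \<rho>' \<in> hom G (Aut_pairing_vec dimension f\<^sub>0) \<and> inj_on \<rho>' (carrier G) \<and>
    (\<forall>g\<in>carrier G. reduces_to (endo_char_poly sc (\<rho> g)) (char_poly (\<rho>' g)))"
proof -
  interpret G: group G by (rule G(1))
  have lin: "Vector_Spaces.linear sc sc (\<rho> g)" and bij: "bij (\<rho> g)"
    and iso: "f (\<rho> g x) (\<rho> g y) = f x y" if "g \<in> carrier G" for g x y
    using hom_in_carrier[OF \<rho>(1) that] by (simp_all add: Aut_pairing_def)
  have mult: "\<rho> (g \<otimes>\<^bsub>G\<^esub> h) = \<rho> g \<circ> \<rho> h" if "g \<in> carrier G" "h \<in> carrier G" for g h
    using hom_mult[OF \<rho>(1) that] by (simp add: Aut_pairing_def)
  \<comment> \<open>\<open>hom\<close> only demands multiplicativity; the image of the unit is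
    idempotent and injective, hence the identity.\<close>
  have one: "\<rho> \<one>\<^bsub>G\<^esub> = id"
  proof
    fix x
    have "\<rho> \<one>\<^bsub>G\<^esub> (\<rho> \<one>\<^bsub>G\<^esub> x) = \<rho> \<one>\<^bsub>G\<^esub> x" using fun_cong[OF mult[of "\<one>\<^bsub>G\<^esub>" "\<one>\<^bsub>G\<^esub>"], of x] by simp
    then show "\<rho> \<one>\<^bsub>G\<^esub> x = id x" using bij_is_inj[OF bij[of "\<one>\<^bsub>G\<^esub>"]] by (simp add: inj_eq)
  qed
  have pow: "\<rho> (g [^]\<^bsub>G\<^esub> (m::nat)) = \<rho> g ^^ m" if "g \<in> carrier G" for g m
  proof (induction m)
    case (Suc m)
    then show ?case using that by (simp add: mult funpow_Suc_right del: funpow.simps)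
  qed (simp add: one)
  obtain y :: "nat \<Rightarrow> 'v" where y:
    "\<And>i j. i < dimension \<Longrightarrow> j < dimension \<Longrightarrow> i \<noteq> j \<Longrightarrow> f (y i) (y j) = 0"
    "\<And>i. i < dimension \<Longrightarrow> f (y i) (y i) \<noteq> 0"
    "\<And>i. i < dimension \<Longrightarrow> val (f (y i) (y i)) \<in> {0, 1}"
    and coeffs: "\<And>g i j. g \<in> \<rho> ` carrier G \<Longrightarrow> i < dimension \<Longrightarrow> j < dimension \<Longrightarrow>
       f (g (y j)) (y i) / f (y i) (y i) \<in>
         val_ge (max 0 (val (f (y j) (y j)) - val (f (y i) (y i))))"
  proof (rule reduced_basis[of "\<rho> ` carrier G"])
    show "finite (\<rho> ` carrier G)" using G(2) by simp
    show "id \<in> \<rho> ` carrier G" using imageI[OF G.one_closed, of \<rho>] by (simp add: one)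
    show "g \<circ> h \<in> \<rho> ` carrier G" if "g \<in> \<rho> ` carrier G" "h \<in> \<rho> ` carrier G" for g h
    proof -
      obtain a where a: "a \<in> carrier G" "g = \<rho> a" using \<open>g \<in> _\<close> by (rule imageE)
      obtain b where b: "b \<in> carrier G" "h = \<rho> b" using \<open>h \<in> _\<close> by (rule imageE)
      have "g \<circ> h = \<rho> (a \<otimes>\<^bsub>G\<^esub> b)" using a b by (simp add: mult)
      then show ?thesis using a(1) b(1) by simp
    qed
    show "\<exists>h\<in>\<rho> ` carrier G. \<forall>x. g (h x) = x" if "g \<in> \<rho> ` carrier G" for g
    proof -
      obtain a where a: "a \<in> carrier G" "g = \<rho> a" using \<open>g \<in> _\<close> by (rule imageE)
      then have "\<rho> a \<circ> \<rho> (inv\<^bsub>G\<^esub> a) = id" using mult[of a "inv\<^bsub>G\<^esub> a"] one by simp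
      then have "\<forall>x. g (\<rho> (inv\<^bsub>G\<^esub> a) x) = x" using a(2) by (simp add: fun_eq_iff)
      moreover have "\<rho> (inv\<^bsub>G\<^esub> a) \<in> \<rho> ` carrier G" using a(1) by simp
      ultimately show ?thesis by blast
    qed
  qed (use lin iso in auto)
  obtain \<pi> :: 'k where "\<pi> \<noteq> 0" "val \<pi> = 1" "\<sigma> \<pi> = \<pi>" by (rule uniformizer)
  then interpret R: reduced_hermitian_space \<iota> \<sigma> sc B f \<epsilon> y \<pi>
    by unfold_locales (use y in auto)
  have adm: "R.admissible (\<rho> g)" if "g \<in> carrier G" for g
    using that lin iso coeffs[of "\<rho> g"]
    by (simp add: R.admissible_def R.coord_def R.c_def R.d_def)
  define \<rho>' where "\<rho>' g = R.red (\<rho> g)" for g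
  have mult': "\<rho>' (g \<otimes>\<^bsub>G\<^esub> h) = \<rho>' g * \<rho>' h" if "g \<in> carrier G" "h \<in> carrier G" for g h
    using that by (simp add: \<rho>'_def mult R.red_comp adm)
  have one': "\<rho>' \<one>\<^bsub>G\<^esub> = 1\<^sub>m dimension" by (simp add: \<rho>'_def one R.red_id)
  have hom: "\<rho>' \<in> hom G (Aut_pairing_vec dimension R.form)"
  proof (rule homI)
    fix g assume g: "g \<in> carrier G"
    have "\<rho>' g * \<rho>' (inv\<^bsub>G\<^esub> g) = 1\<^sub>m dimension" "\<rho>' (inv\<^bsub>G\<^esub> g) * \<rho>' g = 1\<^sub>m dimension"
      using g by (simp_all add: one' flip: mult')
    then have "invertible_mat (\<rho>' g)"
      unfolding invertible_mat_def inverts_mat_def square_mat.simps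
      by (auto simp: \<rho>'_def intro!: exI[of _ "R.red (\<rho> (inv\<^bsub>G\<^esub> g))"])
    then show "\<rho>' g \<in> carrier (Aut_pairing_vec dimension R.form)"
      using R.form_red[OF adm[OF g]] by (simp add: Aut_pairing_vec_def \<rho>'_def)
  qed (simp add: mult' Aut_pairing_vec_def)
  have "inj_on \<rho>' (carrier G)"
  proof (rule inj_onI)
    fix g h assume gh: "g \<in> carrier G" "h \<in> carrier G" and eq: "\<rho>' g = \<rho>' h"
    let ?k = "g \<otimes>\<^bsub>G\<^esub> inv\<^bsub>G\<^esub> h"
    have k: "?k \<in> carrier G" using gh by simp
    have "\<rho>' ?k = 1\<^sub>m dimension" using gh eq by (simp add: mult') (simp add: one' flip: mult')
    \<comment> \<open>The order of the group is a common exponent, which provides the finite order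
      needed by \<open>red_faithful\<close>.\<close>
    moreover have "\<rho> ?k ^^ order G = id" using G.pow_order_eq_1[OF k] pow[OF k, of "order G"] one by simp
    ultimately have "\<rho> ?k = id"
      using R.red_faithful[OF primes adm[OF k]] G(2) by (auto simp: \<rho>'_def G.order_gt_0_iff_finite)
    then have "?k = \<one>\<^bsub>G\<^esub>" using inj_onD[OF \<rho>(2), of ?k "\<one>\<^bsub>G\<^esub>"] k one by simp
    then show "g = h" using gh by (metis G.inv_closed G.inv_equality G.inv_inv)
  qed
  moreover have "\<forall>g\<in>carrier G. reduces_to (endo_char_poly sc (\<rho> g)) (char_poly (\<rho>' g))"
    using R.reduces_to_red adm by (simp add: \<rho>'_def)
  moreover have "\<forall>u v. R.form v u = residue \<epsilon> * residue_conj (R.form u v)"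
    by (intro allI) (rule R.form_swap)
  ultimately show ?thesis using R.form_nondegenerate R.form_sesquilinear hom by blast
qed

text \<open>Otherwise a Bezout relation would put 1 into the maximal ideal. It shows that all primes
  other than the residue characteristic are units.\<close>

lemma coprime_of_nat_val_ge:
  assumes "coprime a b" "(of_nat a :: 'a::discrete_valuation_field) \<in> val_ge 1"
  shows "(of_nat b :: 'a) \<notin> val_ge 1"
proof
  assume b: "(of_nat b :: 'a) \<in> val_ge 1"
  have one: "(1 :: 'a) \<notin> val_ge 1" by (simp add: val_ge_def)
  show False
  \<comment> \<open>The Bezout relation is only available for nonzero \<open>a\<close>; if
    \<open>a = 0\<close>, coprimality gives \<open>b = 1\<close>.\<close>
  proof (cases "a = 0")
    case True
    then show ?thesis using assms(1) b one by simp
  next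
    case False
    then obtain x y where "a * x = b * y + gcd a b" using bezout_nat by blast
    then have "of_nat a * of_nat x - of_nat b * of_nat y = (1 :: 'a)"
      using assms(1) by (simp flip: of_nat_mult)
    moreover have "of_nat a * of_nat x - of_nat b * of_nat y \<in> (val_ge 1 :: 'a set)"
      using assms(2) b of_nat_val_ge by (intro val_ge_diff val_ge_mult_le[of _ 1 _ 0]) auto
    ultimately show ?thesis using one by simp
  qed
qed

theorem theorem5p4:
  fixes l :: nat
    and \<iota> :: "'l::discrete_valuation_field \<Rightarrow> 'k::discrete_valuation_field"
    and sc :: "'k \<Rightarrow> 'v::ab_group_add \<Rightarrow> 'v"
    and B :: "'v set"
    and n :: nat
    and f :: "'v \<Rightarrow> 'v \<Rightarrow> 'k"
    and G :: "('g, 'm) monoid_scheme"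
    and \<rho> :: "'g \<Rightarrow> 'v \<Rightarrow> 'v"
  assumes "prime l"
    and "CHAR('l) = 0"
    and "CHAR('l residue_field) = l"
    and "unramified_extension \<iota>"
    and "ext_degree \<iota> = 2"
    and "2 * val (of_nat l :: 'k) < int l - 1"
    and "finite_dimensional_vector_space sc B"
    and "vector_space.dim sc (UNIV :: 'v set) = n"
    and "nondegenerate UNIV 0 f"
    and "group G"
    and "finite (carrier G)"
    and "\<rho> \<in> hom G (Aut_pairing sc f)"
    and "inj_on \<rho> (carrier G)"
  shows "(hermitian \<iota> UNIV sc f \<longrightarrow>
           (\<exists>f\<^sub>0 :: 'k residue_field vec \<Rightarrow> 'k residue_field vec \<Rightarrow> 'k residue_field.
            \<exists>\<rho>' :: 'g \<Rightarrow> 'k residue_field mat.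
              nondegenerate (carrier_vec n) (0\<^sub>v n) f\<^sub>0 \<and>
              hermitian (residue_map \<iota>) (carrier_vec n) (\<cdot>\<^sub>v) f\<^sub>0 \<and>
              \<rho>' \<in> hom G (Aut_pairing_vec n f\<^sub>0) \<and> inj_on \<rho>' (carrier G) \<and>
              (\<forall>g\<in>carrier G. reduces_to (endo_char_poly sc (\<rho> g)) (char_poly (\<rho>' g)))))
       \<and> (skew_hermitian \<iota> UNIV sc f \<longrightarrow>
           (\<exists>f\<^sub>0 :: 'k residue_field vec \<Rightarrow> 'k residue_field vec \<Rightarrow> 'k residue_field.
            \<exists>\<rho>' :: 'g \<Rightarrow> 'k residue_field mat.
              nondegenerate (carrier_vec n) (0\<^sub>v n) f\<^sub>0 \<and>
              skew_hermitian (residue_map \<iota>) (carrier_vec n) (\<cdot>\<^sub>v) f\<^sub>0 \<and>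
              \<rho>' \<in> hom G (Aut_pairing_vec n f\<^sub>0) \<and> inj_on \<rho>' (carrier G) \<and>
              (\<forall>g\<in>carrier G. reduces_to (endo_char_poly sc (\<rho> g)) (char_poly (\<rho>' g)))))"
proof -
  interpret \<iota>: field_hom \<iota>
    using assms(4) by (simp add: unramified_extension_def)
  interpret V: finite_dimensional_vector_space sc B by (rule assms(7))
  have dim: "V.dimension = n"
    using assms(8) by (simp add: V.dimension_def)
  have val_\<iota>: "val (\<iota> x) = val x" if "x \<noteq> 0" for x
    using assms(4) that by (simp add: unramified_extension_def)
  have nonzero: "(of_nat m :: 'k) \<noteq> 0" if "0 < m" for m
  proof -
    have "(of_nat m :: 'l) \<noteq> 0" using assms(2) that by (simp add: of_nat_eq_0_iff_char_dvd)
    then have "\<iota> (of_nat m) \<noteq> 0" by simp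
    then show ?thesis by (simp add: \<iota>.hom_of_nat)
  qed
  have l0: "0 < l" using assms(1) by (rule prime_gt_0_nat)
  have "residue (of_nat l :: 'l) = 0"
    using of_nat_CHAR[where 'a = "'l residue_field"] assms(3) by (simp add: residue_of_nat)
  then have "(of_nat l :: 'l) \<in> val_ge 1" by (simp add: residue_eq_0_iff of_nat_val_ge)
  moreover have "(of_nat l :: 'l) \<noteq> 0" using assms(2) l0 by (simp add: of_nat_eq_0_iff_char_dvd)
  ultimately have "1 \<le> val (\<iota> (of_nat l))" by (simp add: val_ge_def val_\<iota>)
  then have e: "1 \<le> val (of_nat l :: 'k)" by (simp add: \<iota>.hom_of_nat)
  have l_mem: "(of_nat l :: 'k) \<in> val_ge 1" using e by (simp add: val_ge_def)
  \<comment> \<open>\<open>l\<close> vanishes in the residue field, so its valuation is at least 1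
    and the bound on it excludes \<open>l = 2\<close>.\<close>
  have "l \<noteq> 2" using e assms(6) by auto
  then have "coprime l 2" using assms(1) primes_coprime two_is_prime_nat by blast
  from coprime_of_nat_val_ge[OF this l_mem] have two: "(2 :: 'k) \<notin> val_ge 1" by simp
  have primes: "(of_nat p :: 'k) \<noteq> 0 \<and>
      (val (of_nat p :: 'k) = 0 \<or> 2 * val (of_nat p :: 'k) < int p - 1)" if "prime p" for p
  proof (cases "p = l")
    case True
    then show ?thesis using nonzero[OF l0] assms(6) by simp
  next
    case False
    then have "coprime l p" using assms(1) that by (simp add: primes_coprime)
    then have "(of_nat p :: 'k) \<notin> val_ge 1" using l_mem by (rule coprime_of_nat_val_ge)
    then show ?thesis
      using of_nat_val_ge[of p, where 'a = 'k] by (auto simp: val_ge_def)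
  qed
  \<comment> \<open>Both symmetry types at once; \<open>\<sigma>\<close> is the conjugation that
    comes with the given form.\<close>
  have reduction: "\<exists>\<tau> f\<^sub>0 (\<rho>' :: 'g \<Rightarrow> 'k residue_field mat).
      conjugation (residue_map \<iota>) \<tau> \<and>
      nondegenerate (carrier_vec n) (0\<^sub>v n) f\<^sub>0 \<and>
      sesquilinear (carrier_vec n) (\<cdot>\<^sub>v) \<tau> f\<^sub>0 \<and>
      (\<forall>x y. f\<^sub>0 y x = residue \<epsilon> * \<tau> (f\<^sub>0 x y)) \<and>
      \<rho>' \<in> hom G (Aut_pairing_vec n f\<^sub>0) \<and> inj_on \<rho>' (carrier G) \<and>
      (\<forall>g\<in>carrier G. reduces_to (endo_char_poly sc (\<rho> g)) (char_poly (\<rho>' g)))"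
    if \<sigma>: "conjugation \<iota> \<sigma>" "sesquilinear UNIV sc \<sigma> f" "\<And>x y. f y x = \<epsilon> * \<sigma> (f x y)"
      and \<epsilon>: "\<epsilon> = 1 \<or> \<epsilon> = - 1" for \<sigma> and \<epsilon> :: 'k
  proof -
    interpret U: unramified_quadratic \<iota> \<sigma>
      using assms(4,5) \<sigma>(1) two by (rule unramified_quadratic.intro)
    interpret H: hermitian_space \<iota> \<sigma> sc B f \<epsilon>
    proof unfold_locales
      show "x = 0" if "\<And>y. f x y = 0" for x
        using assms(9) that by (simp add: nondegenerate_def)
    qed (fact \<sigma>(2) \<sigma>(3) \<epsilon>)+
    show ?thesis
      by (rule exI[of _ U.residue_conj])
        (use H.reduction_exists[OF primes assms(10-13), unfolded dim] U.conjugation_residue_conj in simp)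
  qed
  show ?thesis
  proof (intro conjI impI)
    assume "hermitian \<iota> UNIV sc f"
    then obtain \<sigma> where \<sigma>: "conjugation \<iota> \<sigma>" "sesquilinear UNIV sc \<sigma> f" "\<And>x y. f y x = \<sigma> (f x y)"
      unfolding hermitian_def by (metis UNIV_I)
    show "\<exists>f\<^sub>0. \<exists>\<rho>' :: 'g \<Rightarrow> 'k residue_field mat.
        nondegenerate (carrier_vec n) (0\<^sub>v n) f\<^sub>0 \<and>
        hermitian (residue_map \<iota>) (carrier_vec n) (\<cdot>\<^sub>v) f\<^sub>0 \<and>
        \<rho>' \<in> hom G (Aut_pairing_vec n f\<^sub>0) \<and> inj_on \<rho>' (carrier G) \<and>
        (\<forall>g\<in>carrier G. reduces_to (endo_char_poly sc (\<rho> g)) (char_poly (\<rho>' g)))"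
    proof -
      have "f y x = 1 * \<sigma> (f x y)" for x y unfolding mult_1 by (rule \<sigma>(3))
      from reduction[OF \<sigma>(1,2) this disjI1[OF refl]]
      obtain \<tau> f\<^sub>0 and \<rho>' :: "'g \<Rightarrow> 'k residue_field mat" where
        \<tau>: "conjugation (residue_map \<iota>) \<tau>" "sesquilinear (carrier_vec n) (\<cdot>\<^sub>v) \<tau> f\<^sub>0"
          "\<And>x y. f\<^sub>0 y x = residue 1 * \<tau> (f\<^sub>0 x y)"
        and rest: "nondegenerate (carrier_vec n) (0\<^sub>v n) f\<^sub>0"
          "\<rho>' \<in> hom G (Aut_pairing_vec n f\<^sub>0)" "inj_on \<rho>' (carrier G)"
          "\<forall>g\<in>carrier G. reduces_to (endo_char_poly sc (\<rho> g)) (char_poly (\<rho>' g))"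
        by blast
      have "hermitian (residue_map \<iota>) (carrier_vec n) (\<cdot>\<^sub>v) f\<^sub>0"
        using \<tau> unfolding hermitian_def residue_1 mult_1 by blast
      with rest show ?thesis by blast
    qed
  next
    assume "skew_hermitian \<iota> UNIV sc f"
    then obtain \<sigma> where \<sigma>: "conjugation \<iota> \<sigma>" "sesquilinear UNIV sc \<sigma> f" "\<And>x y. f y x = - \<sigma> (f x y)"
      unfolding skew_hermitian_def by (metis UNIV_I)
    have minus: "residue (- 1 :: 'k) = - 1" by (simp add: residue_uminus residue_1)
    show "\<exists>f\<^sub>0. \<exists>\<rho>' :: 'g \<Rightarrow> 'k residue_field mat.
        nondegenerate (carrier_vec n) (0\<^sub>v n) f\<^sub>0 \<and>
        skew_hermitian (residue_map \<iota>) (carrier_vec n) (\<cdot>\<^sub>v) f\<^sub>0 \<and>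
        \<rho>' \<in> hom G (Aut_pairing_vec n f\<^sub>0) \<and> inj_on \<rho>' (carrier G) \<and>
        (\<forall>g\<in>carrier G. reduces_to (endo_char_poly sc (\<rho> g)) (char_poly (\<rho>' g)))"
    proof -
      have "f y x = - 1 * \<sigma> (f x y)" for x y unfolding mult_minus1 by (rule \<sigma>(3))
      from reduction[OF \<sigma>(1,2) this disjI2[OF refl]]
      obtain \<tau> f\<^sub>0 and \<rho>' :: "'g \<Rightarrow> 'k residue_field mat" where
        \<tau>: "conjugation (residue_map \<iota>) \<tau>" "sesquilinear (carrier_vec n) (\<cdot>\<^sub>v) \<tau> f\<^sub>0"
          "\<And>x y. f\<^sub>0 y x = residue (- 1) * \<tau> (f\<^sub>0 x y)"
        and rest: "nondegenerate (carrier_vec n) (0\<^sub>v n) f\<^sub>0"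
          "\<rho>' \<in> hom G (Aut_pairing_vec n f\<^sub>0)" "inj_on \<rho>' (carrier G)"
          "\<forall>g\<in>carrier G. reduces_to (endo_char_poly sc (\<rho> g)) (char_poly (\<rho>' g))"
        by blast
      have "skew_hermitian (residue_map \<iota>) (carrier_vec n) (\<cdot>\<^sub>v) f\<^sub>0"
        using \<tau> unfolding skew_hermitian_def minus mult_minus1 by blast
      with rest show ?thesis by blast
    qed
  qed
qed

end
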